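(* Let $G=(V,E)$ be a connected simple graph with $n$ vertices $V=[n]$ and edges $E=\{e_1,\dots,e_m\}$, let $\mathbf x\in\mathbb{R}^m$ with all entries positive be an edge weight vector giving the positive-weighted graph $G^w$, and let $L$ be its Laplacian matrix with eigenvalues $\lambda_1\ge\lambda_2\ge\cdots\ge\lambda_{n-1}>\lambda_n=0$. Let $d_{\max}$ be the maximum degree of the (unweighted) graph $G$. Then: (a) For all $i,j\in[n]$, every eigenvalue $\mu(\nabla^2 R_{ij}(\mathbf x))$ of the Hessian matrix $\nabla^2 R_{ij}(\mathbf x)$ satisfies $$\mu(\nabla^2 R_{ij}(\mathbf{x})) \leq \frac{4(d_{\max} + 1)}{\lambda_{n-1}} \widehat{R}_{ij},$$ where $\widehat R_{ij}=((L^2)^\dagger)^{(i,j)}$ is the biharmonic distance of $G^w$. (b) Every eigenvalue $\mu(\nabla^2 Kf_G(\mathbf x))$ of the Hessian matrix $\nabla^2 Kf_G(\mathbf x)$ satisfies $$\frac{4n}{\lambda_1^3} \leq \mu(\nabla^2 Kf_G(\mathbf{x})) \leq \frac{4n(d_{\max} + 1)}{\lambda_{n-1}^3}.$$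
   Context: For a connected graph $G$ with positive edge weights $\mathbf x$, the Laplacian is $L=D-A$ where $A_{st}=x_k$ if $\{s,t\}=e_k\in E$ and $0$ otherwise, and $D$ is the diagonal matrix of row sums of $A$; $\lambda_{n-1}$ (the second smallest eigenvalue) is the algebraic connectivity. $L^\dagger$ denotes the Moore–Penrose inverse. For a square matrix $P$, $P^{(i,j)}=P_{ii}+P_{jj}-P_{ij}-P_{ji}$. The resistance distance is $R_{ij}(\mathbf x)=(L^\dagger)^{(i,j)}$ and the Kirchhoff index is $Kf_G(\mathbf x)=\sum_{i<j}R_{ij}(\mathbf x)$, both functions of $\mathbf x$ on the open positive orthant of $\mathbb{R}^m$; $\nabla^2$ denotes the Hessian matrix with respect to $\mathbf x$. *)

theory Defs
  imports "HOL-Analysis.Derivative" "Jordan_Normal_Form.Char_Poly"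
begin

text \<open>Vertices are \<open>0, \<dots>, n - 1\<close>. The edge list \<open>es\<close> is also the enumeration of the edges that
  indexes the weight vector: edge \<open>es ! k\<close> has weight \<open>x $ k\<close>.\<close>

definition simple_graph :: "nat \<Rightarrow> nat set list \<Rightarrow> bool" where
  "simple_graph n es \<longleftrightarrow> distinct es \<and> (\<forall>e\<in>set es. e \<subseteq> {..<n} \<and> card e = 2)"

definition connected_graph :: "nat \<Rightarrow> nat set list \<Rightarrow> bool" where
  "connected_graph n es \<longleftrightarrow> n > 0 \<and>
     (\<forall>s<n. \<forall>t<n. (s, t) \<in> {(u, v). {u, v} \<in> set es}\<^sup>*)"

definition degree_of :: "nat set list \<Rightarrow> nat \<Rightarrow> nat" where
  "degree_of es s = card {e \<in> set es. s \<in> e}"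

definition max_degree :: "nat \<Rightarrow> nat set list \<Rightarrow> nat" where
  "max_degree n es = Max (degree_of es ` {..<n})"

text \<open>As \<open>es\<close> is distinct, the sum below has at most one nonzero term.\<close>

definition adjacency :: "nat \<Rightarrow> nat set list \<Rightarrow> real vec \<Rightarrow> real mat" where
  "adjacency n es x =
     mat n n (\<lambda>(s, t). \<Sum>k<length es. if es ! k = {s, t} then x $ k else 0)"

definition degree_mat :: "nat \<Rightarrow> nat set list \<Rightarrow> real vec \<Rightarrow> real mat" where
  "degree_mat n es x =
     mat n n (\<lambda>(s, t). if s = t then \<Sum>u<n. adjacency n es x $$ (s, u) else 0)"

definition laplacian :: "nat \<Rightarrow> nat set list \<Rightarrow> real vec \<Rightarrow> real mat" where
  "laplacian n es x = degree_mat n es x - adjacency n es x"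

text \<open>The \<open>k\<close>-th largest real eigenvalue, counted from \<open>k = 1\<close> and with algebraic multiplicity.
  This is meant for matrices all of whose eigenvalues are real, such as real symmetric ones.\<close>

definition kth_eigenvalue :: "real mat \<Rightarrow> nat \<Rightarrow> real" where
  "kth_eigenvalue A k = rev (sorted_list_of_multiset (proots (char_poly A))) ! (k - 1)"

definition is_pinv :: "real mat \<Rightarrow> real mat \<Rightarrow> bool" where
  "is_pinv A X \<longleftrightarrow> X \<in> carrier_mat (dim_col A) (dim_row A) \<and>
     A * X * A = A \<and> X * A * X = X \<and>
     transpose_mat (A * X) = A * X \<and> transpose_mat (X * A) = X * A"

definition pinv :: "real mat \<Rightarrow> real mat" where
  "pinv A = (THE X. is_pinv A X)"

text \<open>The quantity \<open>P\<^sup>(\<^sup>i\<^sup>,\<^sup>j\<^sup>)\<close>.\<close>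

definition pair_entry :: "real mat \<Rightarrow> nat \<Rightarrow> nat \<Rightarrow> real" where
  "pair_entry P i j = P $$ (i, i) + P $$ (j, j) - P $$ (i, j) - P $$ (j, i)"

definition resistance :: "nat \<Rightarrow> nat set list \<Rightarrow> nat \<Rightarrow> nat \<Rightarrow> real vec \<Rightarrow> real" where
  "resistance n es i j x = pair_entry (pinv (laplacian n es x)) i j"

definition biharmonic :: "nat \<Rightarrow> nat set list \<Rightarrow> nat \<Rightarrow> nat \<Rightarrow> real vec \<Rightarrow> real" where
  "biharmonic n es i j x = pair_entry (pinv (laplacian n es x ^\<^sub>m 2)) i j"

definition kirchhoff :: "nat \<Rightarrow> nat set list \<Rightarrow> real vec \<Rightarrow> real" where
  "kirchhoff n es x = (\<Sum>j<n. \<Sum>i<j. resistance n es i j x)"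

definition partial :: "nat \<Rightarrow> (real vec \<Rightarrow> real) \<Rightarrow> real vec \<Rightarrow> real" where
  "partial k f x = deriv (\<lambda>t. f (x + t \<cdot>\<^sub>v unit_vec (dim_vec x) k)) 0"

definition hessian :: "(real vec \<Rightarrow> real) \<Rightarrow> real vec \<Rightarrow> real mat" where
  "hessian f x = mat (dim_vec x) (dim_vec x) (\<lambda>(k, l). partial k (partial l f) x)"

end

theory Submission
  imports Defs
begin

text \<open>Let \<open>b\<^sub>k\<close> be the signed incidence vector of edge \<open>k\<close>, so that \<open>L = \<Sum>x\<^sub>k b\<^sub>k b\<^sub>k\<^sup>T\<close>, and let \<open>X\<close> be the
  pseudoinverse of \<open>L\<close>. Moving one weight is a rank-one update of \<open>L\<close>, and the Sherman--Morrison
  formula gives \<open>\<partial>X/\<partial>x\<^sub>k = - X b\<^sub>k b\<^sub>k\<^sup>T X\<close>. With \<open>d = e\<^sub>i - e\<^sub>j\<close> and \<open>c\<^sub>k = b\<^sub>k\<^sup>T X d\<close>, the Hessian of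
  \<open>R\<^sub>i\<^sub>j\<close> therefore has entries \<open>2 c\<^sub>k c\<^sub>l (b\<^sub>k\<^sup>T X b\<^sub>l)\<close>, and that of the Kirchhoff index has entries
  \<open>2 n (b\<^sub>k\<^sup>T X\<^sup>2 b\<^sub>l) (b\<^sub>k\<^sup>T X b\<^sub>l)\<close>. In an orthonormal eigenbasis of \<open>L\<close> these quadratic forms become
  sums of squares weighted by inverse eigenvalues. Bounding the weights by extremal eigenvalues
  leaves \<open>|\<Sum>v\<^sub>k c\<^sub>k b\<^sub>k|\<^sup>2\<close> and \<open>\<Sum>v\<^sub>k v\<^sub>l (b\<^sub>k\<^sup>T b\<^sub>l)\<^sup>2\<close>; the first is controlled by Cauchy--Schwarz at every
  vertex and the largest eigenvalue \<open>deg s + 1\<close> of the star at \<open>s\<close>, and the second equals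
  \<open>2|v|\<^sup>2\<close> plus the sum over the vertices \<open>s\<close> of the squares of \<open>\<Sum>v\<^sub>k\<close> over the edges \<open>k\<close> at \<open>s\<close>.\<close>

no_notation inner (infix "\<bullet>" 70)
unbundle no vec_syntax

section \<open>Spectral theorem for real symmetric matrices\<close>

text \<open>The Householder reflection I - 2 w w^T / |w|^2 with w = v - e_0 exchanges the unit
  vectors e_0 and v.\<close>

lemma householder_exists:
  fixes v :: "real vec"
  assumes v: "v \<in> carrier_vec n" and unit: "scalar_prod v v = 1" and n: "0 < n"
  shows "\<exists>W \<in> carrier_mat n n. transpose_mat W = W \<and> W * W = 1\<^sub>m n \<and> col W 0 = v"
proof -
  define w where "w s = v $ s - of_bool (s = 0)" for s
  \<comment> \<open>Since |v| = 1, |w|^2 = 2 (1 - \<open>v $ 0\<close>), so \<open>a\<close> is 2 /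
    |w|^2. If \<open>v $ 0 = 1\<close>, then w vanishes and \<open>inverse 0 = 0\<close> makes
    \<open>W\<close> the identity.\<close>
  define a where "a = inverse (1 - v $ 0)"
  define W where "W = mat n n (\<lambda>(s, t). of_bool (s = t) - a * w s * w t)"
  have v1: "(\<Sum>s<n. (v $ s)\<^sup>2) = 1"
    using unit v by (simp add: scalar_prod_def power2_eq_square atLeast0LessThan)
  have "(\<Sum>s<n. (w s)\<^sup>2) = (\<Sum>s<n. (v $ s)\<^sup>2 + (if s = 0 then 1 - 2 * v $ 0 else 0))"
    by (intro sum.cong) (auto simp: w_def power2_diff)
  also have "\<dots> = 2 * (1 - v $ 0)"
    using n by (simp add: sum.distrib v1)
  finally have ww: "(\<Sum>s<n. (w s)\<^sup>2) = 2 * (1 - v $ 0)" .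
  have w0: "w s = 0" if "v $ 0 = 1" "s < n" for s
  proof -
    have "(\<Sum>s<n. (w s)\<^sup>2) = 0" using ww that by simp
    thus ?thesis using that by (simp add: sum_nonneg_eq_0_iff)
  qed
  have W: "W \<in> carrier_mat n n" by (simp add: W_def)
  have "transpose_mat W = W"
    by (rule eq_matI) (auto simp: W_def)
  moreover have "col W 0 = v"
  proof (rule eq_vecI)
    fix s assume "s < dim_vec v"
    hence s: "s < n" using v by auto
    have "W $$ (s, 0) = v $ s"
    proof (cases "v $ 0 = 1")
      case True
      with w0[OF True s] n s show ?thesis by (auto simp: W_def w_def)
    next
      case False
      hence "a * (1 - v $ 0) = 1" by (simp add: a_def)
      moreover have "W $$ (s, 0) = of_bool (s = 0) + (a * (1 - v $ 0)) * w s"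
        using s n by (simp add: W_def w_def[of 0] algebra_simps)
      ultimately show ?thesis by (simp add: w_def)
    qed
    thus "col W 0 $ s = v $ s" using W s n by simp
  qed (use W v in simp)
  moreover have "W * W = 1\<^sub>m n"
  proof (rule eq_matI)
    fix s t assume st: "s < dim_row (1\<^sub>m n)" "t < dim_col (1\<^sub>m n)"
    hence s: "s < n" and t: "t < n" by auto
    have "(W * W) $$ (s, t) =
        (\<Sum>r<n. (of_bool (s = r) - a * w s * w r) * (of_bool (r = t) - a * w r * w t))"
      using W s t by (simp add: scalar_prod_def atLeast0LessThan W_def)
    also have "\<dots> = (\<Sum>r<n. of_bool (r = s) * of_bool (s = t) - of_bool (r = s) * (a * w s * w t)
        - of_bool (r = t) * (a * w s * w t) + a\<^sup>2 * w s * w t * (w r)\<^sup>2)"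
      by (intro sum.cong) (auto simp: algebra_simps power2_eq_square)
    also have "\<dots> = of_bool (s = t) - 2 * a * w s * w t + a\<^sup>2 * w s * w t * (2 * (1 - v $ 0))"
      using s t
      by (simp add: sum.distrib sum_subtractf sum_distrib_left[symmetric] ww
          sum_distrib_right[symmetric] of_bool_def)
    also have "\<dots> = of_bool (s = t)"
    proof (cases "v $ 0 = 1")
      case False
      hence "a * (1 - v $ 0) = 1" by (simp add: a_def)
      moreover have "a\<^sup>2 * w s * w t * (2 * (1 - v $ 0)) = 2 * (a * w s * w t) * (a * (1 - v $ 0))"
        by (simp add: power2_eq_square algebra_simps)
      ultimately show ?thesis by simp
    qed (use w0 s in simp)
    finally show "(W * W) $$ (s, t) = 1\<^sub>m n $$ (s, t)" using s t by simp
  qed (use W in auto)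
  ultimately show ?thesis using W by blast
qed

text \<open>Over the complex numbers the characteristic polynomial has a root a. For an eigenvector
  z the number z^* A z equals a |z|^2 and is its own conjugate by symmetry, so a is real.\<close>

lemma symmetric_eigenvalue_exists:
  fixes A :: "real mat"
  assumes A: "A \<in> carrier_mat n n" and sym: "transpose_mat A = A" and n: "0 < n"
  shows "\<exists>e. eigenvalue A e"
proof -
  define C where "C = map_mat complex_of_real A"
  have C: "C \<in> carrier_mat n n" using A by (simp add: C_def)
  have As: "A $$ (s, t) = A $$ (t, s)" if "s < n" "t < n" for s t
    using arg_cong[OF sym, of "\<lambda>M. M $$ (s, t)"] A that by simp
  from char_poly_factorized[OF C] obtain as
    where as: "char_poly C = (\<Prod>a\<leftarrow>as. [:- a, 1:])" "length as = n" by blast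
  with n obtain a bs where abs: "as = a # bs" by (cases as) auto
  have root: "poly (char_poly C) a = 0" by (simp add: as(1) abs)
  hence "eigenvalue C a" using eigenvalue_root_char_poly[OF C] by blast
  then obtain z where z: "z \<in> carrier_vec n" "z \<noteq> 0\<^sub>v n" "C *\<^sub>v z = a \<cdot>\<^sub>v z"
    using C by (auto simp: eigenvalue_def eigenvector_def)
  have Cz: "(\<Sum>t<n. complex_of_real (A $$ (s, t)) * z $ t) = a * z $ s" if "s < n" for s
    using arg_cong[OF z(3), of "\<lambda>u. u $ s"] that A z(1)
    by (simp add: C_def scalar_prod_def atLeast0LessThan)
  define N where "N = (\<Sum>s<n. (cmod (z $ s))\<^sup>2)"
  have "N \<noteq> 0"
  proof
    assume "N = 0"
    hence "z $ s = 0" if "s < n" for s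
      using that by (simp add: N_def sum_nonneg_eq_0_iff)
    hence "z = 0\<^sub>v n" using z(1) by (intro eq_vecI) auto
    thus False using z(2) by blast
  qed
  define Q where "Q = (\<Sum>s<n. \<Sum>t<n. cnj (z $ s) * complex_of_real (A $$ (s, t)) * z $ t)"
  have "Q = (\<Sum>s<n. cnj (z $ s) * (a * z $ s))"
    unfolding Q_def by (intro sum.cong refl) (simp add: Cz[symmetric] sum_distrib_left mult.assoc)
  also have "\<dots> = a * complex_of_real N"
    unfolding N_def of_real_sum sum_distrib_left
    by (intro sum.cong refl) (simp add: complex_norm_square mult_ac del: of_real_power)
  finally have Q: "Q = a * complex_of_real N" .
  have "cnj Q = (\<Sum>s<n. \<Sum>t<n. cnj (z $ t) * complex_of_real (A $$ (s, t)) * z $ s)"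
    by (simp add: Q_def mult_ac)
  also have "\<dots> = (\<Sum>t<n. \<Sum>s<n. cnj (z $ t) * complex_of_real (A $$ (s, t)) * z $ s)"
    by (rule sum.swap)
  also have "\<dots> = Q"
    unfolding Q_def by (intro sum.cong refl) (simp add: As)
  finally have "cnj a * complex_of_real N = a * complex_of_real N" by (simp add: Q)
  hence "cnj a = a" using \<open>N \<noteq> 0\<close> by simp
  then obtain r where r: "a = complex_of_real r"
    by (metis Reals_cases Reals_cnj_iff)
  \<comment> \<open>Forming the characteristic polynomial commutes with the embedding of the reals,
    so the real number \<open>r\<close> is already a root over the reals.\<close>
  have "complex_of_real (poly (char_poly A) r) = poly (map_poly complex_of_real (char_poly A)) a"
    by (simp add: r)
  also have "map_poly complex_of_real (char_poly A) = char_poly C"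
    unfolding C_def by (rule of_real_hom.char_poly_hom[OF A, symmetric])
  finally have "poly (char_poly A) r = 0" using root by simp
  thus ?thesis using eigenvalue_root_char_poly[OF A] by blast
qed

lemma symmetric_unit_eigenvector_exists:
  fixes A :: "real mat"
  assumes A: "A \<in> carrier_mat n n" and sym: "transpose_mat A = A" and n: "0 < n"
  obtains v e where "v \<in> carrier_vec n" "scalar_prod v v = 1" "A *\<^sub>v v = e \<cdot>\<^sub>v v"
proof -
  from symmetric_eigenvalue_exists[OF assms] obtain e where "eigenvalue A e" ..
  then obtain z where z: "z \<in> carrier_vec n" "z \<noteq> 0\<^sub>v n" "A *\<^sub>v z = e \<cdot>\<^sub>v z"
    using A by (auto simp: eigenvalue_def eigenvector_def)
  define c where "c = 1 / sqrt (scalar_prod z z)"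
  have pos: "scalar_prod z z > 0"
    using conjugate_square_greater_0_vec[OF z(1)] z(2) by simp
  have "scalar_prod (c \<cdot>\<^sub>v z) (c \<cdot>\<^sub>v z) = c\<^sup>2 * (scalar_prod z z)"
    using z(1) by (simp add: power2_eq_square)
  also have "\<dots> = 1" using pos by (simp add: c_def power_divide)
  finally have "scalar_prod (c \<cdot>\<^sub>v z) (c \<cdot>\<^sub>v z) = 1" .
  moreover have "A *\<^sub>v (c \<cdot>\<^sub>v z) = e \<cdot>\<^sub>v (c \<cdot>\<^sub>v z)"
    using A z by (simp add: mult_mat_vec smult_smult_assoc mult.commute)
  ultimately show thesis using z(1) by (intro that[of "c \<cdot>\<^sub>v z"]) auto
qed

text \<open>Deflation: a reflection \<open>W\<close> with a unit eigenvector as its first column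
  turns A into \<open>W * A * W\<close>, whose first column is a multiple of e_0. Symmetry clears
  the first row too, and the induction hypothesis diagonalizes the remaining block.\<close>

theorem symmetric_diagonalizable:
  fixes A :: "real mat"
  assumes "A \<in> carrier_mat n n" "transpose_mat A = A"
  shows "\<exists>U\<in>carrier_mat n n. \<exists>D\<in>carrier_mat n n.
    transpose_mat U * U = 1\<^sub>m n \<and> diagonal_mat D \<and> A * U = U * D"
  using assms
proof (induction n arbitrary: A)
  case 0
  show ?case
    by (intro bexI[of _ "1\<^sub>m 0"]) (use 0 in \<open>auto simp: diagonal_mat_def\<close>)
next
  case (Suc n)
  note A = Suc.prems(1) and sym = Suc.prems(2)
  obtain v e where v: "v \<in> carrier_vec (Suc n)" "scalar_prod v v = 1" "A *\<^sub>v v = e \<cdot>\<^sub>v v"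
    using symmetric_unit_eigenvector_exists[OF A sym] by auto
  obtain W where W: "W \<in> carrier_mat (Suc n) (Suc n)" "transpose_mat W = W"
      "W * W = 1\<^sub>m (Suc n)" "col W 0 = v"
    using householder_exists[OF v(1,2)] by auto
  define A' where "A' = W * A * W"
  have A': "A' \<in> carrier_mat (Suc n) (Suc n)" using A W by (simp add: A'_def)
  have sym': "transpose_mat A' = A'"
    using A W sym by (simp add: A'_def transpose_mult[of _ "Suc n" "Suc n" _ "Suc n"] assoc_mult_mat[of _ "Suc n" "Suc n" _ "Suc n" _ "Suc n"])
  have As: "A' $$ (s, t) = A' $$ (t, s)" if "s < Suc n" "t < Suc n" for s t
    using arg_cong[OF sym', of "\<lambda>M. M $$ (s, t)"] A' that by simp
  have "col A' 0 = W *\<^sub>v (A *\<^sub>v v)"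
    using A W by (simp add: A'_def assoc_mult_mat[of _ "Suc n" "Suc n" _ "Suc n" _ "Suc n"] col_mult2[of _ "Suc n" "Suc n" _ "Suc n"]
        mult_mat_vec_def)
  also have "\<dots> = e \<cdot>\<^sub>v (W *\<^sub>v col W 0)"
    using W v by (simp add: mult_mat_vec)
  \<comment> \<open>This is column 0 of \<open>W * W = 1\<close>: the reflection sends its own first
    column to e_0.\<close>
  also have "W *\<^sub>v col W 0 = unit_vec (Suc n) 0"
    using W(1,3) by (metis col_mult2 col_one zero_less_Suc)
  finally have col0: "col A' 0 = e \<cdot>\<^sub>v unit_vec (Suc n) 0" .
  have A's0: "A' $$ (s, 0) = (if s = 0 then e else 0)" if "s < Suc n" for s
    using arg_cong[OF col0, of "\<lambda>u. u $ s"] A' that by auto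
  define A3 where "A3 = mat n n (\<lambda>(s, t). A' $$ (Suc s, Suc t))"
  have A3: "A3 \<in> carrier_mat n n" "transpose_mat A3 = A3"
    using As by (auto simp: A3_def)
  define E where "E = mat 1 1 (\<lambda>_. e)"
  have E: "E \<in> carrier_mat 1 1" by (simp add: E_def)
  have A'_block: "A' = four_block_mat E (0\<^sub>m 1 n) (0\<^sub>m n 1) A3"
  proof (rule eq_matI)
    fix s t
    assume "s < dim_row (four_block_mat E (0\<^sub>m 1 n) (0\<^sub>m n 1) A3)"
      "t < dim_col (four_block_mat E (0\<^sub>m 1 n) (0\<^sub>m n 1) A3)"
    hence st: "s < Suc n" "t < Suc n" using E A3 by auto
    show "A' $$ (s, t) = four_block_mat E (0\<^sub>m 1 n) (0\<^sub>m n 1) A3 $$ (s, t)"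
      using st A's0[of s] A's0[of t] As[of s t] by (cases s; cases t) (auto simp: E_def A3_def)
  qed (use E A3 A' in auto)
  from Suc.IH[OF A3] obtain U3 D3 where U3: "U3 \<in> carrier_mat n n" "D3 \<in> carrier_mat n n"
      "transpose_mat U3 * U3 = 1\<^sub>m n" "diagonal_mat D3" "A3 * U3 = U3 * D3" by blast
  define V where "V = four_block_mat (1\<^sub>m 1) (0\<^sub>m 1 n) (0\<^sub>m n 1) U3"
  define D where "D = four_block_mat E (0\<^sub>m 1 n) (0\<^sub>m n 1) D3"
  have V: "V \<in> carrier_mat (Suc n) (Suc n)" and D: "D \<in> carrier_mat (Suc n) (Suc n)"
    using U3 E by (auto simp: V_def D_def)
  have VV: "transpose_mat V * V = 1\<^sub>m (Suc n)"
  proof -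
    have "transpose_mat V * V = four_block_mat (1\<^sub>m 1) (0\<^sub>m 1 n) (0\<^sub>m n 1) (1\<^sub>m n)"
      unfolding V_def using U3
      by (simp add: transpose_four_block_mat[of _ 1 1 _ n _ n] mult_four_block_mat[of _ 1 1 _ n _ n _ _ 1 _ n])
    also have "\<dots> = 1\<^sub>m (Suc n)" by (rule eq_matI) auto
    finally show ?thesis .
  qed
  have AV: "A' * V = V * D"
    unfolding A'_block V_def D_def using U3 E A3
    by (simp add: mult_four_block_mat[of _ 1 1 _ n _ n _ _ 1 _ n])
  have WW: "W * (W * M) = M" if "M \<in> carrier_mat (Suc n) (Suc n)" for M
    using W that by (simp add: assoc_mult_mat[of W "Suc n" "Suc n" W "Suc n" M "Suc n", symmetric])
  have "diagonal_mat D"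
    using U3(2,4) E by (auto simp: diagonal_mat_def D_def)
  moreover have "transpose_mat (W * V) * (W * V) = 1\<^sub>m (Suc n)"
    using W V VV by (simp add: WW transpose_mult[of _ "Suc n" "Suc n" _ "Suc n"]
        assoc_mult_mat[of _ "Suc n" "Suc n" _ "Suc n" _ "Suc n"])
  moreover have "A * (W * V) = W * (A' * V)"
    using A W V by (simp add: WW A'_def assoc_mult_mat[of _ "Suc n" "Suc n" _ "Suc n" _ "Suc n"])
  hence "A * (W * V) = (W * V) * D"
    using W V D by (simp add: AV assoc_mult_mat[of _ "Suc n" "Suc n" _ "Suc n" _ "Suc n"])
  ultimately show ?case using W V D by (intro bexI[of _ "W * V"] bexI[of _ D]) auto
qed

section \<open>Spectral form of the pseudoinverse\<close>

text \<open>From here on vectors are functions of which only the values below \<open>n\<close>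
  count; sums over them carry no dimension conditions.\<close>

definition dot :: "nat \<Rightarrow> (nat \<Rightarrow> real) \<Rightarrow> (nat \<Rightarrow> real) \<Rightarrow> real" where
  "dot n p q = (\<Sum>s<n. p s * q s)"

definition bform :: "nat \<Rightarrow> real mat \<Rightarrow> (nat \<Rightarrow> real) \<Rightarrow> (nat \<Rightarrow> real) \<Rightarrow> real" where
  "bform n M p q = (\<Sum>s<n. \<Sum>t<n. p s * M $$ (s, t) * q t)"

text \<open>With U the matrix whose columns are the \<open>u k\<close>, the two conditions are U^T U
  = 1 (orthonormality) and U U^T = 1 (completeness).\<close>

definition orthonormal_basis :: "nat \<Rightarrow> (nat \<Rightarrow> nat \<Rightarrow> real) \<Rightarrow> bool" where
  "orthonormal_basis n u \<longleftrightarrow>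
     (\<forall>k<n. \<forall>l<n. dot n (u k) (u l) = of_bool (k = l)) \<and>
     (\<forall>s<n. \<forall>t<n. (\<Sum>k<n. u k s * u k t) = of_bool (s = t))"

text \<open>This is U diag(g) U^T. For a fixed orthonormal basis it is a functional calculus:
  products and pseudoinverses become pointwise operations on \<open>g\<close>.\<close>

definition spectral_mat :: "nat \<Rightarrow> (nat \<Rightarrow> nat \<Rightarrow> real) \<Rightarrow> (nat \<Rightarrow> real) \<Rightarrow> real mat" where
  "spectral_mat n u g = mat n n (\<lambda>(s, t). \<Sum>k<n. g k * u k s * u k t)"

lemma spectral_mat_carrier [simp]: "spectral_mat n u g \<in> carrier_mat n n"
  by (simp add: spectral_mat_def)

lemma spectral_mat_dim [simp]:
  "dim_row (spectral_mat n u g) = n" "dim_col (spectral_mat n u g) = n"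
  by (simp_all add: spectral_mat_def)

lemma transpose_spectral_mat [simp]: "transpose_mat (spectral_mat n u g) = spectral_mat n u g"
  by (rule eq_matI) (auto simp: spectral_mat_def mult_ac)

lemma spectral_mat_mult:
  assumes u: "orthonormal_basis n u"
  shows "spectral_mat n u g * spectral_mat n u h = spectral_mat n u (\<lambda>k. g k * h k)"
proof (rule eq_matI)
  fix s t assume "s < dim_row (spectral_mat n u (\<lambda>k. g k * h k))"
    "t < dim_col (spectral_mat n u (\<lambda>k. g k * h k))"
  hence st: "s < n" "t < n" by simp_all
  have "(spectral_mat n u g * spectral_mat n u h) $$ (s, t)
      = (\<Sum>r<n. (\<Sum>k<n. g k * u k s * u k r) * (\<Sum>l<n. h l * u l r * u l t))"
    using st by (simp add: scalar_prod_def atLeast0LessThan spectral_mat_def)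
  also have "\<dots> = (\<Sum>r<n. \<Sum>k<n. \<Sum>l<n. (g k * u k s) * (h l * u l t) * (u k r * u l r))"
    by (simp add: sum_product mult_ac)
  also have "\<dots> = (\<Sum>k<n. \<Sum>l<n. \<Sum>r<n. (g k * u k s) * (h l * u l t) * (u k r * u l r))"
    by (subst sum.swap, rule sum.cong[OF refl], rule sum.swap)
  also have "\<dots> = (\<Sum>k<n. \<Sum>l<n. (g k * u k s) * (h l * u l t) * dot n (u k) (u l))"
    by (simp add: dot_def sum_distrib_left)
  also have "\<dots> = (\<Sum>k<n. \<Sum>l<n. (g k * u k s) * (h l * u l t) * of_bool (k = l))"
    using u by (intro sum.cong refl) (simp add: orthonormal_basis_def)
  also have "\<dots> = (\<Sum>k<n. g k * h k * u k s * u k t)"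
    by (simp add: of_bool_def if_distrib[of "\<lambda>x. _ * x"] sum.delta' mult_ac cong: if_cong)
  finally show "(spectral_mat n u g * spectral_mat n u h) $$ (s, t)
      = spectral_mat n u (\<lambda>k. g k * h k) $$ (s, t)"
    using st by (simp add: spectral_mat_def)
qed simp_all

text \<open>Penrose's argument: the symmetry conditions give A X = A Y and X A = Y A, whence X = X A
  X = Y A X = Y A Y = Y.\<close>

lemma is_pinv_unique:
  assumes X: "is_pinv A X" and Y: "is_pinv A Y"
  shows "X = Y"
proof -
  define m where "m = dim_row A"
  define n where "n = dim_col A"
  have A: "A \<in> carrier_mat m n" by (simp add: m_def n_def)
  have cX: "X \<in> carrier_mat n m" and cY: "Y \<in> carrier_mat n m"
    using X Y by (auto simp: is_pinv_def m_def n_def)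
  have X': "A * X * A = A" "X * A * X = X" "transpose_mat (A * X) = A * X" "transpose_mat (X * A) = X * A"
    using X by (auto simp: is_pinv_def)
  have Y': "A * Y * A = A" "Y * A * Y = Y" "transpose_mat (A * Y) = A * Y" "transpose_mat (Y * A) = Y * A"
    using Y by (auto simp: is_pinv_def)
  have "A * X = transpose_mat (A * Y * A * X)"
    by (simp add: X'(3) Y'(1))
  also have "A * Y * A * X = (A * Y) * (A * X)"
    using A cX cY by (intro assoc_mult_mat[of _ m m _ n _ m]) auto
  also have "transpose_mat \<dots> = (A * X) * (A * Y)"
    using A cX cY by (simp add: transpose_mult[of _ m m _ m] X'(3) Y'(3))
  also have "\<dots> = A * X * A * Y"
    using A cX cY by (intro assoc_mult_mat[of _ m m _ n _ m, symmetric]) auto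
  finally have AXY: "A * X = A * Y" by (simp add: X'(1))
  have "X * A = X * (A * Y * A)" by (simp add: Y'(1))
  also have "\<dots> = (X * A) * (Y * A)"
    using A cX cY by (simp add: assoc_mult_mat[of _ n n _ n _ n] assoc_mult_mat[of _ m n _ m _ n]
        assoc_mult_mat[of _ n m _ n _ n])
  also have "\<dots> = transpose_mat ((Y * A) * (X * A))"
    using A cX cY by (simp add: transpose_mult[of _ n n _ n] X'(4) Y'(4))
  also have "(Y * A) * (X * A) = Y * (A * X * A)"
    using A cX cY by (simp add: assoc_mult_mat[of _ n n _ n _ n] assoc_mult_mat[of _ m n _ m _ n]
        assoc_mult_mat[of _ n m _ n _ n])
  finally have XYA: "X * A = Y * A" by (simp add: X'(1) Y'(4))
  have "X = Y * A * X" by (metis X'(2) XYA)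
  also have "\<dots> = Y * (A * Y)"
    using A cX cY by (simp add: assoc_mult_mat[of _ n m _ n _ m] AXY)
  also have "\<dots> = Y"
    using A cX cY Y'(2) by (simp add: assoc_mult_mat[of _ n m _ n _ m])
  finally show ?thesis .
qed

lemma pinv_eqI: "is_pinv A X \<Longrightarrow> pinv A = X"
  unfolding pinv_def by (rule the_equality) (auto intro: is_pinv_unique)

text \<open>As \<open>inverse 0 = 0\<close>, the kernel needs no separate treatment.\<close>

lemma is_pinv_spectral_mat:
  assumes u: "orthonormal_basis n u"
  shows "is_pinv (spectral_mat n u g) (spectral_mat n u (\<lambda>k. inverse (g k)))"
proof -
  have "(\<lambda>k. g k * inverse (g k) * g k) = g" "(\<lambda>k. inverse (g k) * g k * inverse (g k)) = (\<lambda>k. inverse (g k))"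
    by (auto simp: fun_eq_iff field_simps)
  thus ?thesis by (simp add: is_pinv_def spectral_mat_mult[OF u])
qed

lemmas pinv_spectral_mat = pinv_eqI[OF is_pinv_spectral_mat]

lemma mult_mat_entry:
  fixes A B :: "real mat"
  assumes "A \<in> carrier_mat n n" "B \<in> carrier_mat n n" "s < n" "t < n"
  shows "(A * B) $$ (s, t) = (\<Sum>r<n. A $$ (s, r) * B $$ (r, t))"
  using assms by (simp add: scalar_prod_def atLeast0LessThan)

text \<open>Ties eigenvalues counted as roots of the characteristic polynomial to an eigenbasis in
  the same decreasing order, so that \<open>e k\<close> is the eigenvalue numbered k + 1.\<close>

lemma symmetric_spectral_mat:
  fixes A :: "real mat"
  assumes A: "A \<in> carrier_mat n n" and sym: "transpose_mat A = A"
  obtains u e where "orthonormal_basis n u" "A = spectral_mat n u e"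
    "\<And>i j. i \<le> j \<Longrightarrow> j < n \<Longrightarrow> e j \<le> e i"
    "\<And>k. k < n \<Longrightarrow> kth_eigenvalue A (Suc k) = e k"
proof -
  from symmetric_diagonalizable[OF A sym] obtain U D where
    U: "U \<in> carrier_mat n n" and D: "D \<in> carrier_mat n n" and
    UU: "transpose_mat U * U = 1\<^sub>m n" and diag: "diagonal_mat D" and AU: "A * U = U * D" by blast
  have UU': "U * transpose_mat U = 1\<^sub>m n"
    using mat_mult_left_right_inverse[OF _ U UU] U by simp
  have A_eq: "A = U * D * transpose_mat U"
    using A U D UU' by (simp add: AU[symmetric] assoc_mult_mat[of _ n n _ n _ n])
  define d where "d k = D $$ (k, k)" for k
  define v where "v k s = U $$ (s, k)" for k s
  \<comment> \<open>One permutation, by decreasing eigenvalue, reorders eigenvectors and eigenvalues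
    together.\<close>
  define q where "q = rev (sort_key d [0..<n])"
  have q: "length q = n" "distinct q" "set q = {..<n}"
    by (auto simp: q_def)
  have bij: "bij_betw (\<lambda>k. q ! k) {..<n} {..<n}"
    using q(1,3) by (intro bij_betw_nth[OF q(2)]) simp_all
  have qn: "q ! k < n" if "k < n" for k
    using bij that by (auto simp: bij_betw_def)
  have A_entry: "A $$ (s, t) = (\<Sum>k<n. d k * v k s * v k t)" if "s < n" "t < n" for s t
  proof -
    have "(U * D) $$ (s, k) = v k s * d k" if "k < n" for k
    proof -
      have "(U * D) $$ (s, k) = (\<Sum>l<n. U $$ (s, l) * D $$ (l, k))"
        using U D \<open>s < n\<close> that by (simp add: scalar_prod_def atLeast0LessThan)
      also have "\<dots> = (\<Sum>l<n. if l = k then U $$ (s, l) * D $$ (l, k) else 0)"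
        using diag D that by (intro sum.cong) (auto simp: diagonal_mat_def)
      finally show ?thesis using that by (simp add: v_def d_def)
    qed
    moreover have "A $$ (s, t) = (\<Sum>k<n. (U * D) $$ (s, k) * U $$ (t, k))"
      unfolding A_eq using U D that
      by (subst mult_mat_entry[of _ n]) (auto simp del: index_mult_mat intro!: sum.cong)
    ultimately show ?thesis by (simp add: v_def mult_ac)
  qed
  have basis: "orthonormal_basis n (\<lambda>k. v (q ! k))"
    unfolding orthonormal_basis_def
  proof (intro conjI allI impI)
    fix k l assume kl: "k < n" "l < n"
    have "dot n (v (q ! k)) (v (q ! l)) = (transpose_mat U * U) $$ (q ! k, q ! l)"
      using U kl qn by (simp add: dot_def v_def scalar_prod_def atLeast0LessThan)
    also have "\<dots> = of_bool (k = l)"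
      using kl qn q by (simp add: UU nth_eq_iff_index_eq)
    finally show "dot n (v (q ! k)) (v (q ! l)) = of_bool (k = l)" .
  next
    fix s t assume st: "s < n" "t < n"
    have "(\<Sum>k<n. v (q ! k) s * v (q ! k) t) = (\<Sum>k<n. v k s * v k t)"
      by (rule sum.reindex_bij_betw[OF bij, of "\<lambda>k. v k s * v k t"])
    also have "\<dots> = (U * transpose_mat U) $$ (s, t)"
      using U st by (simp add: v_def scalar_prod_def atLeast0LessThan)
    also have "\<dots> = of_bool (s = t)" using st by (simp add: UU')
    finally show "(\<Sum>k<n. v (q ! k) s * v (q ! k) t) = of_bool (s = t)" .
  qed
  have A_spec: "A = spectral_mat n (\<lambda>k. v (q ! k)) (\<lambda>k. d (q ! k))"
  proof (rule eq_matI)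
    fix s t assume "s < dim_row (spectral_mat n (\<lambda>k. v (q ! k)) (\<lambda>k. d (q ! k)))"
      "t < dim_col (spectral_mat n (\<lambda>k. v (q ! k)) (\<lambda>k. d (q ! k)))"
    hence st: "s < n" "t < n" by auto
    show "A $$ (s, t) = spectral_mat n (\<lambda>k. v (q ! k)) (\<lambda>k. d (q ! k)) $$ (s, t)"
      using st A_entry[OF st] sum.reindex_bij_betw[OF bij, of "\<lambda>k. d k * v k s * v k t"]
      by (simp add: spectral_mat_def)
  qed (use A in auto)
  have sorted: "sorted (map d (sort_key d [0..<n]))" by simp
  have mono: "d (q ! j) \<le> d (q ! i)" if "i \<le> j" "j < n" for i j
  proof -
    have "rev (map d q) = map d (sort_key d [0..<n])" by (simp add: q_def rev_map)
    hence "sorted (rev (map d q))" by simp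
    hence "map d q ! j \<le> map d q ! i"
      using sorted_rev_nth_mono[of "map d q" i j] that q by simp
    thus ?thesis using that q by simp
  qed
  \<comment> \<open>Similarity preserves the characteristic polynomial, so its roots with
    multiplicity are the diagonal entries of \<open>D\<close>.\<close>
  have "similar_mat A D"
    by (rule similar_matI[of _ _ U "transpose_mat U" n]) (use A U D UU UU' A_eq in auto)
  hence "char_poly A = char_poly D" by (rule char_poly_similar)
  also have "\<dots> = (\<Prod>a\<leftarrow>diag_mat D. [:- a, 1:])"
    by (rule char_poly_upper_triangular[OF D])
      (use diag D in \<open>auto simp: upper_triangular_def diagonal_mat_def\<close>)
  also have "diag_mat D = map d [0..<n]"
    using D by (auto simp: diag_mat_def d_def)
  finally have "proots (char_poly A) = proots (\<Prod>p\<leftarrow>map (\<lambda>a. [:- a, 1:]) (map d [0..<n]). p)"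
    by simp
  also have "\<dots> = (\<Sum>p\<leftarrow>map (\<lambda>a. [:- a, 1:]) (map d [0..<n]). proots p)"
    by (rule proots_prod_list) auto
  also have "\<dots> = (\<Sum>a\<leftarrow>map d [0..<n]. {#a#})" by (simp add: o_def)
  also have "\<dots> = mset (map d [0..<n])"
  proof -
    have "(\<Sum>a\<leftarrow>xs. {#a#}) = mset xs" for xs :: "real list" by (induction xs) auto
    thus ?thesis .
  qed
  finally have "sorted_list_of_multiset (proots (char_poly A)) = sort (map d [0..<n])"
    by (simp only: sorted_list_of_multiset_mset)
  also have "\<dots> = map d (sort_key d [0..<n])"
    by (rule properties_for_sort) (simp_all add: sorted)
  finally have "kth_eigenvalue A (Suc k) = d (q ! k)" if "k < n" for k
    using that by (simp add: kth_eigenvalue_def q_def rev_map rev_nth)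
  with basis A_spec mono show thesis by (intro that) auto
qed

lemma bform_spectral_mat:
  "bform n (spectral_mat n u g) p q = (\<Sum>k<n. g k * dot n (u k) p * dot n (u k) q)"
proof -
  have "bform n (spectral_mat n u g) p q = (\<Sum>s<n. \<Sum>t<n. \<Sum>k<n. g k * (u k s * p s) * (u k t * q t))"
    by (simp add: bform_def spectral_mat_def sum_distrib_left sum_distrib_right mult_ac)
  also have "\<dots> = (\<Sum>s<n. \<Sum>k<n. \<Sum>t<n. g k * (u k s * p s) * (u k t * q t))"
    by (rule sum.cong[OF refl], rule sum.swap)
  also have "\<dots> = (\<Sum>k<n. \<Sum>s<n. \<Sum>t<n. g k * (u k s * p s) * (u k t * q t))"
    by (rule sum.swap)
  also have "\<dots> = (\<Sum>k<n. g k * dot n (u k) p * dot n (u k) q)"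
    by (simp add: dot_def sum_product sum_distrib_left mult_ac)
  finally show ?thesis .
qed

text \<open>Completeness says that \<open>spectral_mat n u (\<lambda>_. 1)\<close> is the identity
  matrix; its bilinear form is evaluated in both ways.\<close>

lemma parseval:
  assumes u: "orthonormal_basis n u"
  shows "(\<Sum>k<n. dot n (u k) p * dot n (u k) q) = dot n p q"
proof -
  have "spectral_mat n u (\<lambda>_. 1) = 1\<^sub>m n"
    using u by (intro eq_matI) (auto simp: spectral_mat_def orthonormal_basis_def)
  with bform_spectral_mat[of n u "\<lambda>_. 1" p q]
  have "(\<Sum>k<n. dot n (u k) p * dot n (u k) q) = (\<Sum>s<n. \<Sum>t<n. p s * of_bool (s = t) * q t)"
    by (simp add: bform_def of_bool_def)
  also have "\<dots> = dot n p q"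
    by (simp add: dot_def of_bool_def if_distrib[of "\<lambda>x. _ * x"] if_distrib[of "\<lambda>x. x * _"] sum.delta' cong: if_cong)
  finally show ?thesis .
qed

section \<open>Rank-one updates of the Laplacian\<close>

lemma dot_commute: "dot n p q = dot n q p"
  by (simp add: dot_def mult.commute)

lemma orthonormal_expansion:
  assumes u: "orthonormal_basis n u" and s: "s < n"
  shows "p s = (\<Sum>k<n. dot n (u k) p * u k s)"
proof -
  have *: "dot n q (\<lambda>t. of_bool (t = s)) = q s" for q
    using s by (simp add: dot_def of_bool_def if_distrib[of "\<lambda>x. _ * x"] cong: if_cong)
  show ?thesis using parseval[OF u, of p "\<lambda>t. of_bool (t = s)"] by (simp add: *)
qed

text \<open>Lets vector identities be checked coordinate by coordinate in the eigenbasis.\<close>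

lemma orthonormal_ext:
  assumes u: "orthonormal_basis n u" and s: "s < n"
    and "\<And>k. k < n \<Longrightarrow> dot n (u k) p = dot n (u k) q"
  shows "p s = q s"
  using assms by (simp add: orthonormal_expansion[OF u s, of p] orthonormal_expansion[OF u s, of q])

definition apply_mat :: "nat \<Rightarrow> real mat \<Rightarrow> (nat \<Rightarrow> real) \<Rightarrow> nat \<Rightarrow> real" where
  "apply_mat n M p s = (\<Sum>t<n. M $$ (s, t) * p t)"

lemma bform_apply_mat: "bform n M p q = dot n p (apply_mat n M q)"
  by (simp add: bform_def dot_def apply_mat_def sum_distrib_left mult.assoc)

lemma dot_apply_spectral_mat:
  assumes u: "orthonormal_basis n u" and k: "k < n"
  shows "dot n (u k) (apply_mat n (spectral_mat n u g) p) = g k * dot n (u k) p"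
proof -
  have "bform n (spectral_mat n u g) (u k) p = (\<Sum>l<n. g l * of_bool (l = k) * dot n (u l) p)"
    unfolding bform_spectral_mat using u k
    by (intro sum.cong refl) (simp add: orthonormal_basis_def)
  also have "\<dots> = g k * dot n (u k) p"
    using k by (simp add: of_bool_def if_distrib[of "\<lambda>x. _ * x"] if_distrib[of "\<lambda>x. x * _"] cong: if_cong)
  finally show ?thesis by (simp add: bform_apply_mat)
qed

lemma bform_spectral_mat_commute:
  "bform n (spectral_mat n u g) p q = bform n (spectral_mat n u g) q p"
  by (simp add: bform_spectral_mat mult_ac)

definition rank_one_update :: "nat \<Rightarrow> real mat \<Rightarrow> real \<Rightarrow> (nat \<Rightarrow> real) \<Rightarrow> real mat" where
  "rank_one_update n A c b = mat n n (\<lambda>(s, t). A $$ (s, t) + c * b s * b t)"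

lemma rank_one_update_carrier [simp]: "rank_one_update n A c b \<in> carrier_mat n n"
  by (simp add: rank_one_update_def)

lemma transpose_rank_one_update:
  assumes "A \<in> carrier_mat n n" "transpose_mat A = A"
  shows "transpose_mat (rank_one_update n A c b) = rank_one_update n A c b"
proof (rule eq_matI)
  fix s t assume "s < dim_row (rank_one_update n A c b)" "t < dim_col (rank_one_update n A c b)"
  hence st: "s < n" "t < n" by (auto simp: rank_one_update_def)
  have "A $$ (t, s) = A $$ (s, t)"
    using arg_cong[OF assms(2), of "\<lambda>M. M $$ (s, t)"] assms(1) st by simp
  thus "transpose_mat (rank_one_update n A c b) $$ (s, t) = rank_one_update n A c b $$ (s, t)"
    using st by (simp add: rank_one_update_def mult_ac)
qed (auto simp: rank_one_update_def)

text \<open>Meant for a projection \<open>P\<close> onto the range of \<open>A\<close>: when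
  \<open>b\<close> lies in that range as well, the update does not leave it.\<close>

lemma mult_rank_one_update:
  assumes P: "P \<in> carrier_mat n n" and A: "A \<in> carrier_mat n n" and PA: "P * A = A"
    and Pb: "\<And>s. s < n \<Longrightarrow> apply_mat n P b s = b s"
  shows "P * rank_one_update n A c b = rank_one_update n A c b"
proof (rule eq_matI)
  fix s t assume "s < dim_row (rank_one_update n A c b)" "t < dim_col (rank_one_update n A c b)"
  hence st: "s < n" "t < n" by (auto simp: rank_one_update_def)
  have "(P * rank_one_update n A c b) $$ (s, t) = (\<Sum>r<n. P $$ (s, r) * (A $$ (r, t) + c * b r * b t))"
    using st P by (subst mult_mat_entry[of _ n]) (auto simp: rank_one_update_def)
  also have "\<dots> = (P * A) $$ (s, t) + apply_mat n P b s * (c * b t)"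
    using st P A by (simp add: mult_mat_entry[of _ n] apply_mat_def algebra_simps sum.distrib
        sum_distrib_left sum_distrib_right del: index_mult_mat)
  finally show "(P * rank_one_update n A c b) $$ (s, t) = rank_one_update n A c b $$ (s, t)"
    using st by (simp add: PA Pb rank_one_update_def mult_ac)
qed (use P in \<open>auto simp: rank_one_update_def\<close>)

text \<open>The Sherman--Morrison formula survives for the pseudoinverse because \<open>b\<close> lies in the range.\<close>

lemma is_pinv_rank_one_update:
  assumes u: "orthonormal_basis n u" and A: "A = spectral_mat n u e"
    and X: "X = spectral_mat n u (\<lambda>k. inverse (e k))"
    and b: "\<And>k. k < n \<Longrightarrow> e k = 0 \<Longrightarrow> dot n (u k) b = 0"
    and ne: "1 + c * bform n X b b \<noteq> 0"
  shows "is_pinv (rank_one_update n A c b)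
     (rank_one_update n X (- (c / (1 + c * bform n X b b))) (apply_mat n X b))"
proof -
  define r where "r = bform n X b b"
  define w where "w = apply_mat n X b"
  define a where "a = c / (1 + c * r)"
  \<comment> \<open>The orthogonal projection onto the range of \<open>A\<close>. All four Penrose
    conditions follow once \<open>A'\<close> and \<open>X'\<close> have product \<open>P\<close> in
    both orders and are fixed by \<open>P\<close>, which is symmetric.\<close>
  define P where "P = spectral_mat n u (\<lambda>k. of_bool (e k \<noteq> 0))"
  define A' where "A' = rank_one_update n A c b"
  define X' where "X' = rank_one_update n X (- a) w"
  have carr: "A \<in> carrier_mat n n" "X \<in> carrier_mat n n" "P \<in> carrier_mat n n"
    "A' \<in> carrier_mat n n" "X' \<in> carrier_mat n n"
    by (simp_all add: A X P_def A'_def X'_def)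
  have sym: "transpose_mat A = A" "transpose_mat X = X" "transpose_mat P = P"
    by (simp_all add: A X P_def)
  have sym': "transpose_mat A' = A'" "transpose_mat X' = X'"
    using carr sym by (simp_all add: A'_def X'_def transpose_rank_one_update)
  have w: "dot n (u k) w = inverse (e k) * dot n (u k) b" if "k < n" for k
    unfolding w_def X by (rule dot_apply_spectral_mat[OF u that])
  have Aw: "apply_mat n A w s = b s" if "s < n" for s
    using u that
  proof (rule orthonormal_ext)
    fix k assume k: "k < n"
    show "dot n (u k) (apply_mat n A w) = dot n (u k) b"
      using b[OF k] by (cases "e k = 0") (simp_all add: A dot_apply_spectral_mat[OF u k] w[OF k])
  qed
  have Pb: "apply_mat n P b s = b s" if "s < n" for s
    using u that by (rule orthonormal_ext) (use b in \<open>auto simp: P_def dot_apply_spectral_mat[OF u]\<close>)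
  have Pw: "apply_mat n P w s = w s" if "s < n" for s
    using u that by (rule orthonormal_ext) (use b in \<open>auto simp: P_def dot_apply_spectral_mat[OF u] w\<close>)
  have bw: "(\<Sum>s<n. b s * w s) = r"
    by (simp add: r_def w_def bform_apply_mat dot_def)
  have bX: "(\<Sum>s<n. b s * X $$ (s, t)) = w t" if "t < n" for t
    using that by (simp add: w_def apply_mat_def X spectral_mat_def mult_ac)
  have AX: "A * X = P" and PA: "P * A = A" and PX: "P * X = X"
    unfolding A X P_def spectral_mat_mult[OF u]
    by (auto intro!: arg_cong[where f = "spectral_mat n u"])
  \<comment> \<open>The coefficient of b w^T in \<open>A' * X' - P\<close>; the choice of
    \<open>a\<close> makes it vanish.\<close>
  have a: "c - a - c * a * r = 0"
    using ne by (simp add: a_def r_def field_simps)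
  have A'X': "A' * X' = P"
  proof (rule eq_matI)
    fix s t assume "s < dim_row P" "t < dim_col P"
    hence st: "s < n" "t < n" by (auto simp: P_def)
    have "(A' * X') $$ (s, t) = (\<Sum>i<n. (A $$ (s, i) + c * b s * b i) * (X $$ (i, t) - a * w i * w t))"
      using st carr by (subst mult_mat_entry[of _ n]) (auto simp: A'_def X'_def rank_one_update_def)
    also have "\<dots> = (\<Sum>i<n. A $$ (s, i) * X $$ (i, t)) - (\<Sum>i<n. A $$ (s, i) * w i) * (a * w t)
        + c * b s * (\<Sum>i<n. b i * X $$ (i, t)) - c * b s * a * w t * (\<Sum>i<n. b i * w i)"
      unfolding sum_distrib_left sum_distrib_right sum_subtractf[symmetric] sum.distrib[symmetric]
      by (intro sum.cong refl) (simp add: algebra_simps)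
    also have "\<dots> = P $$ (s, t) + b s * w t * (c - a - c * a * r)"
      using st carr Aw[of s] AX[symmetric]
      by (simp add: bw bX apply_mat_def mult_mat_entry[of _ n] algebra_simps del: index_mult_mat)
    finally show "(A' * X') $$ (s, t) = P $$ (s, t)" by (simp add: a)
  qed (use carr in auto)
  have "X' * A' = transpose_mat (A' * X')"
    using carr by (simp add: transpose_mult[of _ n n _ n] sym')
  hence X'A': "X' * A' = P" by (simp add: A'X' sym)
  have "P * A' = A'" "P * X' = X'"
    unfolding A'_def X'_def using carr PA PX Pb Pw by (auto intro!: mult_rank_one_update)
  with A'X' X'A' carr sym show ?thesis
    by (simp add: is_pinv_def A'_def[symmetric] X'_def[symmetric] a_def[symmetric] r_def[symmetric]
        w_def[symmetric])
qed

lemma bform_pinv_rank_one_update: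
  assumes "orthonormal_basis n u" "A = spectral_mat n u e"
    and X: "X = spectral_mat n u (\<lambda>k. inverse (e k))"
    and "\<And>k. k < n \<Longrightarrow> e k = 0 \<Longrightarrow> dot n (u k) b = 0"
    and "1 + c * bform n X b b \<noteq> 0"
  shows "bform n (pinv (rank_one_update n A c b)) p q =
    bform n X p q - c / (1 + c * bform n X b b) * (bform n X p b * bform n X b q)"
proof -
  define a where "a = c / (1 + c * bform n X b b)"
  define w where "w = apply_mat n X b"
  have "bform n (pinv (rank_one_update n A c b)) p q = bform n (rank_one_update n X (- a) w) p q"
    using pinv_eqI[OF is_pinv_rank_one_update[OF assms]] by (simp add: a_def w_def)
  also have "\<dots> = (\<Sum>s<n. \<Sum>t<n. p s * X $$ (s, t) * q t - a * ((p s * w s) * (w t * q t)))"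
    unfolding bform_def by (intro sum.cong refl) (simp add: rank_one_update_def algebra_simps)
  also have "\<dots> = bform n X p q - a * (dot n p w * dot n w q)"
    unfolding bform_def dot_def sum_product sum_subtractf by (simp only: sum_distrib_left)
  also have "dot n w q = bform n X b q"
    using bform_spectral_mat_commute[of n u "\<lambda>k. inverse (e k)" b q]
    by (simp add: w_def X bform_apply_mat dot_commute)
  finally show ?thesis by (simp add: a_def w_def bform_apply_mat)
qed

section \<open>Incidence vectors and the Laplacian\<close>

definition edge_vec :: "nat set \<Rightarrow> nat \<Rightarrow> real" where
  "edge_vec e s = (if s \<notin> e then 0 else if s = Min e then 1 else -1)"

text \<open>The sign +1 sits at the smaller endpoint. This orientation is only a choice, since the
  Laplacian sees an edge vector b through b b^T. As a difference of indicators, b yields to case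
  distinctions.\<close>

lemma edge_cases:
  assumes "simple_graph n es" "k < length es"
  obtains a b where "a < b" "b < n" "es ! k = {a, b}"
    "edge_vec (es ! k) = (\<lambda>s. of_bool (s = a) - of_bool (s = b))"
proof -
  have "card (es ! k) = 2" "es ! k \<subseteq> {..<n}" using assms by (auto simp: simple_graph_def)
  then obtain a' b' where ab': "es ! k = {a', b'}" "a' \<noteq> b'" by (meson card_2_iff)
  then obtain a b where ab: "es ! k = {a, b}" "a < b"
    by (metis insert_commute linorder_neqE_nat)
  moreover have "b < n" using subsetD[OF \<open>es ! k \<subseteq> {..<n}\<close>, of b] by (simp add: ab(1))
  moreover have "edge_vec (es ! k) = (\<lambda>s. of_bool (s = a) - of_bool (s = b))"
    unfolding ab(1) using ab(2) by (auto simp: edge_vec_def fun_eq_iff)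
  ultimately show thesis using that by blast
qed

lemma laplacian_carrier [simp]: "laplacian n es x \<in> carrier_mat n n"
  unfolding laplacian_def degree_mat_def adjacency_def by (rule minus_carrier_mat) simp

text \<open>L = B diag(x) B^T with B the oriented incidence matrix. Off the diagonal the two ends of
  an edge have opposite signs; on the diagonal the row sum is regrouped by edges.\<close>

lemma laplacian_entry:
  assumes g: "simple_graph n es" and st: "s < n" "t < n"
  shows "laplacian n es x $$ (s, t) = (\<Sum>k<length es. x $ k * edge_vec (es ! k) s * edge_vec (es ! k) t)"
proof (cases "s = t")
  case False
  have "laplacian n es x $$ (s, t) = - (\<Sum>k<length es. if es ! k = {s, t} then x $ k else 0)"
    using st False by (simp add: laplacian_def degree_mat_def adjacency_def)
  also have "\<dots> = (\<Sum>k<length es. x $ k * edge_vec (es ! k) s * edge_vec (es ! k) t)"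
    unfolding sum_negf[symmetric]
  proof (intro sum.cong refl)
    fix k assume "k \<in> {..<length es}"
    then obtain a b where ab: "a < b" "b < n" "es ! k = {a, b}"
      "edge_vec (es ! k) = (\<lambda>s. of_bool (s = a) - of_bool (s = b))"
      using edge_cases[OF g, of k] by blast
    show "- (if es ! k = {s, t} then x $ k else 0) = x $ k * edge_vec (es ! k) s * edge_vec (es ! k) t"
      unfolding ab(4) using False ab(1) by (auto simp: ab(3) doubleton_eq_iff)
  qed
  finally show ?thesis .
next
  case True
  \<comment> \<open>There are no loops, so the adjacency matrix has zero diagonal.\<close>
  have [simp]: "es ! k \<noteq> {t}" if "k < length es" for k
  proof -
    have "card (es ! k) = 2" using g that by (simp add: simple_graph_def)
    thus ?thesis by auto
  qed
  have "laplacian n es x $$ (s, t) = (\<Sum>u<n. \<Sum>k<length es. if es ! k = {s, u} then x $ k else 0)"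
    using st True by (simp add: laplacian_def degree_mat_def adjacency_def)
  also have "\<dots> = (\<Sum>k<length es. \<Sum>u<n. if es ! k = {s, u} then x $ k else 0)" by (rule sum.swap)
  also have "\<dots> = (\<Sum>k<length es. x $ k * edge_vec (es ! k) s * edge_vec (es ! k) t)"
  proof (intro sum.cong refl)
    fix k assume "k \<in> {..<length es}"
    then obtain a b where ab: "a < b" "b < n" "es ! k = {a, b}"
      "edge_vec (es ! k) = (\<lambda>s. of_bool (s = a) - of_bool (s = b))"
      using edge_cases[OF g, of k] by blast
    have "(\<Sum>u<n. if es ! k = {s, u} then x $ k else 0)
        = (\<Sum>u<n. (if s = a \<and> u = b then x $ k else 0) + (if s = b \<and> u = a then x $ k else 0))"
      using ab by (intro sum.cong) (auto simp: doubleton_eq_iff)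
    also have "\<dots> = (if s = a then x $ k else 0) + (if s = b then x $ k else 0)"
      using ab by (simp add: sum.distrib)
    also have "\<dots> = x $ k * edge_vec (es ! k) s * edge_vec (es ! k) t"
      unfolding ab(4) using ab(1) True by auto
    finally show "(\<Sum>u<n. if es ! k = {s, u} then x $ k else 0) = x $ k * edge_vec (es ! k) s * edge_vec (es ! k) t" .
  qed
  finally show ?thesis .
qed

lemma transpose_laplacian:
  assumes "simple_graph n es"
  shows "transpose_mat (laplacian n es x) = laplacian n es x"
  by (rule eq_matI) (auto simp: laplacian_entry[OF assms] mult_ac laplacian_carrier[THEN carrier_matD(1)]
    laplacian_carrier[THEN carrier_matD(2)])

text \<open>The Dirichlet energy, from which both positivity and the kernel of L are read
  off.\<close>

lemma bform_laplacian:
  assumes "simple_graph n es"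
  shows "bform n (laplacian n es x) p p = (\<Sum>k<length es. x $ k * (dot n (edge_vec (es ! k)) p)\<^sup>2)"
proof -
  let ?b = "\<lambda>k. edge_vec (es ! k)"
  have "bform n (laplacian n es x) p p
      = (\<Sum>s<n. \<Sum>t<n. \<Sum>k<length es. x $ k * ((?b k s * p s) * (?b k t * p t)))"
    by (simp add: bform_def laplacian_entry[OF assms] sum_distrib_left sum_distrib_right mult_ac)
  also have "\<dots> = (\<Sum>s<n. \<Sum>k<length es. \<Sum>t<n. x $ k * ((?b k s * p s) * (?b k t * p t)))"
    by (rule sum.cong[OF refl], rule sum.swap)
  also have "\<dots> = (\<Sum>k<length es. \<Sum>s<n. \<Sum>t<n. x $ k * ((?b k s * p s) * (?b k t * p t)))"
    by (rule sum.swap)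
  also have "\<dots> = (\<Sum>k<length es. x $ k * (dot n (?b k) p)\<^sup>2)"
    unfolding dot_def power2_eq_square sum_product by (simp only: sum_distrib_left)
  finally show ?thesis .
qed

lemma laplacian_update:
  assumes g: "simple_graph n es" and y: "y \<in> carrier_vec (length es)" and l: "l < length es"
  shows "laplacian n es (y + c \<cdot>\<^sub>v unit_vec (length es) l) =
    rank_one_update n (laplacian n es y) c (edge_vec (es ! l))"
proof (rule eq_matI)
  fix s t assume "s < dim_row (rank_one_update n (laplacian n es y) c (edge_vec (es ! l)))"
    "t < dim_col (rank_one_update n (laplacian n es y) c (edge_vec (es ! l)))"
  hence st: "s < n" "t < n" by (auto simp: rank_one_update_def)
  let ?f = "\<lambda>k. edge_vec (es ! k) s * edge_vec (es ! k) t"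
  have "laplacian n es (y + c \<cdot>\<^sub>v unit_vec (length es) l) $$ (s, t)
      = (\<Sum>k<length es. y $ k * ?f k + (if k = l then c * ?f k else 0))"
    unfolding laplacian_entry[OF g st] using y l by (intro sum.cong refl) (auto simp: algebra_simps)
  also have "\<dots> = laplacian n es y $$ (s, t) + c * ?f l"
    using l by (simp add: sum.distrib laplacian_entry[OF g st] mult_ac)
  finally show "laplacian n es (y + c \<cdot>\<^sub>v unit_vec (length es) l) $$ (s, t)
      = rank_one_update n (laplacian n es y) c (edge_vec (es ! l)) $$ (s, t)"
    using st by (simp add: rank_one_update_def mult_ac)
qed (auto simp: rank_one_update_def laplacian_carrier[THEN carrier_matD(1)] laplacian_carrier[THEN carrier_matD(2)])

section \<open>Derivatives of the resistance distances\<close>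

definition positive_weights :: "nat set list \<Rightarrow> real vec \<Rightarrow> bool" where
  "positive_weights es x \<longleftrightarrow> x \<in> carrier_vec (length es) \<and> (\<forall>k<length es. 0 < x $ k)"

text \<open>The discrete Green form p^T L^+ q as a function of the weights. Partial derivatives of
  its values are again polynomials in its values, so second derivatives stay within reach of one
  formula.\<close>

definition green :: "nat \<Rightarrow> nat set list \<Rightarrow> (nat \<Rightarrow> real) \<Rightarrow> (nat \<Rightarrow> real) \<Rightarrow> real vec \<Rightarrow> real" where
  "green n es p q x = bform n (pinv (laplacian n es x)) p q"

text \<open>The Rayleigh quotient of the unit eigenvector \<open>u j\<close>.\<close>

lemma laplacian_eigenvalue_eq:
  assumes g: "simple_graph n es" and u: "orthonormal_basis n u"
    and L: "laplacian n es x = spectral_mat n u e" and j: "j < n"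
  shows "e j = (\<Sum>k<length es. x $ k * (dot n (edge_vec (es ! k)) (u j))\<^sup>2)"
proof -
  have "bform n (laplacian n es x) (u j) (u j) = dot n (u j) (u j) * e j"
    by (simp add: L bform_apply_mat dot_apply_spectral_mat[OF u j])
  thus ?thesis using u j by (simp add: bform_laplacian[OF g] orthonormal_basis_def)
qed

text \<open>An eigenvalue is a sum of nonnegative terms; if it is 0, positive weights make its
  eigenvector orthogonal to every edge vector. Thus edge vectors lie in the range of L, as the
  rank-one update formula demands.\<close>

lemma laplacian_spectrum:
  assumes g: "simple_graph n es" and x: "positive_weights es x"
  obtains u e where "orthonormal_basis n u" "laplacian n es x = spectral_mat n u e"
    "pinv (laplacian n es x) = spectral_mat n u (\<lambda>k. inverse (e k))"
    "\<And>i j. i \<le> j \<Longrightarrow> j < n \<Longrightarrow> e j \<le> e i"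
    "\<And>k. k < n \<Longrightarrow> kth_eigenvalue (laplacian n es x) (Suc k) = e k"
    "\<And>k. k < n \<Longrightarrow> 0 \<le> e k"
    "\<And>j k. j < n \<Longrightarrow> e j = 0 \<Longrightarrow> k < length es \<Longrightarrow> dot n (u j) (edge_vec (es ! k)) = 0"
proof -
  obtain u e where ue: "orthonormal_basis n u" "laplacian n es x = spectral_mat n u e"
    "\<And>i j. i \<le> j \<Longrightarrow> j < n \<Longrightarrow> e j \<le> e i"
    "\<And>k. k < n \<Longrightarrow> kth_eigenvalue (laplacian n es x) (Suc k) = e k"
    using symmetric_spectral_mat[OF laplacian_carrier transpose_laplacian[OF g]] by metis
  have nonneg: "0 \<le> x $ k * (dot n (edge_vec (es ! k)) (u j))\<^sup>2" if "k < length es" for j k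
    using x that by (simp add: positive_weights_def less_imp_le)
  have "0 \<le> e j" if "j < n" for j
    unfolding laplacian_eigenvalue_eq[OF g ue(1,2) that] by (intro sum_nonneg nonneg) auto
  moreover have "dot n (u j) (edge_vec (es ! k)) = 0" if "j < n" "e j = 0" "k < length es" for j k
  proof -
    have "(\<Sum>k<length es. x $ k * (dot n (edge_vec (es ! k)) (u j))\<^sup>2) = 0"
      using laplacian_eigenvalue_eq[OF g ue(1,2) that(1)] that(2) by simp
    hence "x $ k * (dot n (edge_vec (es ! k)) (u j))\<^sup>2 = 0"
      using that(3) nonneg by (subst (asm) sum_nonneg_eq_0_iff) auto
    moreover have "x $ k > 0" using x that(3) by (simp add: positive_weights_def)
    ultimately show ?thesis by (simp add: dot_commute)
  qed
  moreover have "pinv (laplacian n es x) = spectral_mat n u (\<lambda>k. inverse (e k))"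
    unfolding ue(2) by (rule pinv_spectral_mat[OF ue(1)])
  ultimately show thesis using ue by (intro that[of u e]) auto
qed

lemma green_commute:
  assumes "simple_graph n es" "positive_weights es x"
  shows "green n es p q x = green n es q p x"
proof -
  obtain u e where "pinv (laplacian n es x) = spectral_mat n u (\<lambda>k. inverse (e k))"
    using laplacian_spectrum[OF assms] by metis
  thus ?thesis by (simp add: green_def bform_spectral_mat_commute)
qed

lemma green_update:
  assumes g: "simple_graph n es" and x: "positive_weights es x" and l: "l < length es"
    and ne: "1 + c * green n es (edge_vec (es ! l)) (edge_vec (es ! l)) x \<noteq> 0"
  shows "green n es p q (x + c \<cdot>\<^sub>v unit_vec (length es) l) = green n es p q x
    - c / (1 + c * green n es (edge_vec (es ! l)) (edge_vec (es ! l)) x)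
      * (green n es p (edge_vec (es ! l)) x * green n es (edge_vec (es ! l)) q x)"
proof -
  obtain u e where ue: "orthonormal_basis n u" "laplacian n es x = spectral_mat n u e"
    "pinv (laplacian n es x) = spectral_mat n u (\<lambda>k. inverse (e k))"
    "\<And>j k. j < n \<Longrightarrow> e j = 0 \<Longrightarrow> k < length es \<Longrightarrow> dot n (u j) (edge_vec (es ! k)) = 0"
    using laplacian_spectrum[OF g x] by metis
  have xc: "x \<in> carrier_vec (length es)" using x by (simp add: positive_weights_def)
  show ?thesis
    using bform_pinv_rank_one_update[OF ue(1,2,3), of "edge_vec (es ! l)" c] ue(4) l ne
    by (simp add: green_def laplacian_update[OF g xc l])
qed

text \<open>The update formula holds where 1 + c r is nonzero, which is an open set around 0, and c
  / (1 + c r) has derivative 1 at 0.\<close>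

lemma green_has_derivative:
  assumes g: "simple_graph n es" and x: "positive_weights es x" and l: "l < length es"
  shows "((\<lambda>c. green n es p q (x + c \<cdot>\<^sub>v unit_vec (length es) l)) has_real_derivative
    - (green n es p (edge_vec (es ! l)) x * green n es (edge_vec (es ! l)) q x)) (at 0)"
proof -
  define r where "r = green n es (edge_vec (es ! l)) (edge_vec (es ! l)) x"
  define a where "a = green n es p (edge_vec (es ! l)) x * green n es (edge_vec (es ! l)) q x"
  have "((\<lambda>c. green n es p q x - c / (1 + c * r) * a) has_real_derivative - a) (at 0)"
    by (auto intro!: derivative_eq_intros)
  moreover have "open {c. 1 + c * r \<noteq> 0}"
    by (intro open_Collect_neq continuous_intros)
  moreover have "0 \<in> {c. 1 + c * r \<noteq> 0}" by simp
  moreover have "green n es p q x - c / (1 + c * r) * a = green n es p q (x + c \<cdot>\<^sub>v unit_vec (length es) l)"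
    if "c \<in> {c. 1 + c * r \<noteq> 0}" for c
    using green_update[OF g x l, of c p q] that by (simp add: r_def a_def)
  ultimately show ?thesis
    unfolding a_def[symmetric] by (rule has_field_derivative_transform_within_open)
qed

text \<open>Two applications of the derivative formula, the second through the product rule. A sum
  over a family of vectors covers a single resistance distance and the Kirchhoff index at
  once.\<close>

lemma hessian_green_sum:
  assumes g: "simple_graph n es" and x: "positive_weights es x"
    and k: "k < length es" and l: "l < length es"
  shows "hessian (\<lambda>y. \<Sum>a\<in>I. green n es (p a) (p a) y) x $$ (k, l) =
    (\<Sum>a\<in>I. 2 * (green n es (p a) (edge_vec (es ! k)) x * green n es (p a) (edge_vec (es ! l)) x)
      * green n es (edge_vec (es ! k)) (edge_vec (es ! l)) x)"
proof -
  define b where "b i = edge_vec (es ! i)" for i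
  let ?m = "length es"
  let ?G = "green n es"
  define f where "f = (\<lambda>y. \<Sum>a\<in>I. ?G (p a) (p a) y)"
  have dim: "dim_vec x = ?m" using x by (simp add: positive_weights_def)
  have partial_f: "partial l f y = (\<Sum>a\<in>I. - (?G (p a) (b l) y * ?G (b l) (p a) y))"
    if y: "positive_weights es y" for y
  proof -
    have "dim_vec y = ?m" using y by (simp add: positive_weights_def)
    thus ?thesis unfolding partial_def f_def b_def
      by (intro DERIV_imp_deriv) (simp add: DERIV_sum green_has_derivative[OF g y l])
  qed
  \<comment> \<open>A second derivative needs the first one on a neighbourhood of 0; for c > -
    \<open>x $ k\<close> the moved weights stay positive.\<close>
  have line: "positive_weights es (x + c \<cdot>\<^sub>v unit_vec ?m k)" if "c \<in> {- (x $ k)<..}" for c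
    unfolding positive_weights_def
  proof (intro conjI allI impI)
    fix i assume i: "i < ?m"
    have "0 < x $ i" using x i by (simp add: positive_weights_def)
    thus "0 < (x + c \<cdot>\<^sub>v unit_vec ?m k) $ i" using i k that dim by (cases "i = k") auto
  qed (use x in \<open>auto simp: positive_weights_def\<close>)
  have x0: "x + 0 \<cdot>\<^sub>v unit_vec ?m k = x" using dim by (intro eq_vecI) auto
  have "((\<lambda>c. partial l f (x + c \<cdot>\<^sub>v unit_vec ?m k)) has_real_derivative
      (\<Sum>a\<in>I. - (- (?G (p a) (b k) x * ?G (b k) (b l) x) * ?G (b l) (p a) x
        + - (?G (b l) (b k) x * ?G (b k) (p a) x) * ?G (p a) (b l) x))) (at 0)"
  proof (rule has_field_derivative_transform_within_open)
    show "((\<lambda>c. \<Sum>a\<in>I. - (?G (p a) (b l) (x + c \<cdot>\<^sub>v unit_vec ?m k) * ?G (b l) (p a) (x + c \<cdot>\<^sub>v unit_vec ?m k)))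
      has_real_derivative
      (\<Sum>a\<in>I. - (- (?G (p a) (b k) x * ?G (b k) (b l) x) * ?G (b l) (p a) x
        + - (?G (b l) (b k) x * ?G (b k) (p a) x) * ?G (p a) (b l) x))) (at 0)"
    proof (intro DERIV_sum DERIV_minus)
      fix a
      show "((\<lambda>c. ?G (p a) (b l) (x + c \<cdot>\<^sub>v unit_vec ?m k) * ?G (b l) (p a) (x + c \<cdot>\<^sub>v unit_vec ?m k))
        has_real_derivative
        (- (?G (p a) (b k) x * ?G (b k) (b l) x) * ?G (b l) (p a) x
        + - (?G (b l) (b k) x * ?G (b k) (p a) x) * ?G (p a) (b l) x)) (at 0)"
        using DERIV_mult[OF green_has_derivative[OF g x k, of "p a" "b l"]
            green_has_derivative[OF g x k, of "b l" "p a"]]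
        by (simp add: x0 b_def)
    qed
    show "open {- (x $ k)<..}" by simp
    show "0 \<in> {- (x $ k)<..}" using x k by (simp add: positive_weights_def)
    show "(\<Sum>a\<in>I. - (?G (p a) (b l) (x + c \<cdot>\<^sub>v unit_vec ?m k) * ?G (b l) (p a) (x + c \<cdot>\<^sub>v unit_vec ?m k)))
      = partial l f (x + c \<cdot>\<^sub>v unit_vec ?m k)" if "c \<in> {- (x $ k)<..}" for c
      using partial_f[OF line[OF that]] by simp
  qed
  hence "partial k (partial l f) x = (\<Sum>a\<in>I. - (- (?G (p a) (b k) x * ?G (b k) (b l) x) * ?G (b l) (p a) x
        + - (?G (b l) (b k) x * ?G (b k) (p a) x) * ?G (p a) (b l) x))"
    unfolding partial_def[of k] dim by (rule DERIV_imp_deriv)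
  \<comment> \<open>Symmetry of the Green form makes the two product rule terms equal, hence the
    factor 2.\<close>
  also have "\<dots> = (\<Sum>a\<in>I. 2 * (?G (p a) (b k) x * ?G (p a) (b l) x) * ?G (b k) (b l) x)"
  proof (intro sum.cong refl)
    fix a
    show "- (- (?G (p a) (b k) x * ?G (b k) (b l) x) * ?G (b l) (p a) x
        + - (?G (b l) (b k) x * ?G (b k) (p a) x) * ?G (p a) (b l) x)
      = 2 * (?G (p a) (b k) x * ?G (p a) (b l) x) * ?G (b k) (b l) x"
      using green_commute[OF g x, of "b k" "p a"] green_commute[OF g x, of "b l" "p a"]
        green_commute[OF g x, of "b l" "b k"] by simp
  qed
  finally show ?thesis
    using k l dim by (simp add: hessian_def f_def[symmetric] b_def)
qed

section \<open>Resistance distance and Kirchhoff index in terms of the Green form\<close>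

definition pair_vec :: "nat \<Rightarrow> nat \<Rightarrow> nat \<Rightarrow> real" where
  "pair_vec i j s = of_bool (s = i) - of_bool (s = j)"

lemma dot_pair_vec:
  assumes "i < n" "j < n"
  shows "dot n (pair_vec i j) p = p i - p j"
proof -
  have "dot n (pair_vec i j) p = (\<Sum>s<n. (if s = i then p s else 0) - (if s = j then p s else 0))"
    unfolding dot_def by (intro sum.cong) (auto simp: pair_vec_def)
  thus ?thesis using assms by (simp add: sum_subtractf)
qed

lemma pair_entry_eq_bform:
  assumes "i < n" "j < n"
  shows "pair_entry P i j = bform n P (pair_vec i j) (pair_vec i j)"
proof -
  have "apply_mat n P (pair_vec i j) s = P $$ (s, i) - P $$ (s, j)" for s
    using dot_pair_vec[OF assms, of "\<lambda>t. P $$ (s, t)"]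
    by (simp add: apply_mat_def dot_def mult.commute)
  thus ?thesis by (simp add: bform_apply_mat dot_pair_vec[OF assms] pair_entry_def)
qed

lemma resistance_eq_green:
  "i < n \<Longrightarrow> j < n \<Longrightarrow> resistance n es i j x = green n es (pair_vec i j) (pair_vec i j) x"
  by (simp add: resistance_def green_def pair_entry_eq_bform)

lemma kirchhoff_eq_green:
  "kirchhoff n es x = (\<Sum>(j, i)\<in>Sigma {..<n} (\<lambda>j. {..<j}). green n es (pair_vec i j) (pair_vec i j) x)"
  by (simp add: kirchhoff_def sum.Sigma[symmetric] resistance_eq_green)

section \<open>Edge inequalities and the spectral gap\<close>

lemma dot_sum_right: "dot n p (\<lambda>s. \<Sum>k\<in>K. w k * b k s) = (\<Sum>k\<in>K. w k * dot n p (b k))"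
proof -
  have "dot n p (\<lambda>s. \<Sum>k\<in>K. w k * b k s) = (\<Sum>s<n. \<Sum>k\<in>K. w k * (p s * b k s))"
    by (simp add: dot_def sum_distrib_left mult_ac)
  also have "\<dots> = (\<Sum>k\<in>K. \<Sum>s<n. w k * (p s * b k s))" by (rule sum.swap)
  finally show ?thesis by (simp add: dot_def sum_distrib_left)
qed

text \<open>For sequences with sum 0 the last product drops out, which is how the factor
  \<open>n\<close> enters the Kirchhoff Hessian.\<close>

lemma sum_pairwise_differences:
  fixes a b :: "nat \<Rightarrow> real"
  shows "(\<Sum>j<n. \<Sum>i<j. (a i - a j) * (b i - b j)) = real n * (\<Sum>i<n. a i * b i) - (\<Sum>i<n. a i) * (\<Sum>i<n. b i)"
proof (induction n)
  case (Suc n)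
  have "(\<Sum>i<n. (a i - a n) * (b i - b n))
      = (\<Sum>i<n. a i * b i) - a n * (\<Sum>i<n. b i) - (\<Sum>i<n. a i) * b n + real n * (a n * b n)"
    by (simp add: algebra_simps sum.distrib sum_subtractf sum_distrib_left)
  thus ?case using Suc by (simp add: algebra_simps)
qed simp

text \<open>An eigenvector is the test vector, so bounds on the quadratic form become bounds on
  \<mu> after division by |v|^2.\<close>

lemma quadratic_form_eigenvalue:
  fixes H :: "real mat"
  assumes H: "H \<in> carrier_mat m m" and ev: "eigenvalue H \<mu>"
  obtains v where "0 < (\<Sum>k<m. (v k)\<^sup>2)"
    "(\<Sum>k<m. \<Sum>l<m. v k * H $$ (k, l) * v l) = \<mu> * (\<Sum>k<m. (v k)\<^sup>2)"
proof -
  obtain z where z: "z \<in> carrier_vec m" "z \<noteq> 0\<^sub>v m" "H *\<^sub>v z = \<mu> \<cdot>\<^sub>v z"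
    using ev H by (auto simp: eigenvalue_def eigenvector_def)
  have Hz: "(\<Sum>l<m. H $$ (k, l) * z $ l) = \<mu> * z $ k" if "k < m" for k
    using arg_cong[OF z(3), of "\<lambda>u. u $ k"] that H z(1) by (simp add: scalar_prod_def atLeast0LessThan)
  have "(\<Sum>k<m. (z $ k)\<^sup>2) \<noteq> 0"
  proof
    assume "(\<Sum>k<m. (z $ k)\<^sup>2) = 0"
    hence "z $ k = 0" if "k < m" for k using that by (simp add: sum_nonneg_eq_0_iff)
    hence "z = 0\<^sub>v m" using z(1) by (intro eq_vecI) auto
    thus False using z(2) by blast
  qed
  moreover have "(\<Sum>k<m. (z $ k)\<^sup>2) \<ge> 0" by (intro sum_nonneg) auto
  ultimately have "(\<Sum>k<m. (z $ k)\<^sup>2) > 0" by linarith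
  moreover have "(\<Sum>l<m. z $ k * H $$ (k, l) * z $ l) = \<mu> * (z $ k)\<^sup>2" if "k < m" for k
  proof -
    have "(\<Sum>l<m. z $ k * H $$ (k, l) * z $ l) = z $ k * (\<Sum>l<m. H $$ (k, l) * z $ l)"
      by (simp only: sum_distrib_left mult.assoc)
    thus ?thesis by (simp add: Hz[OF that] power2_eq_square)
  qed
  hence "(\<Sum>k<m. \<Sum>l<m. z $ k * H $$ (k, l) * z $ l) = \<mu> * (\<Sum>k<m. (z $ k)\<^sup>2)"
    by (simp add: sum_distrib_left)
  ultimately show thesis by (rule that)
qed

text \<open>Handshake argument: every edge is counted once at each of its two endpoints.\<close>

lemma sum_incident_edges:
  fixes f :: "nat \<Rightarrow> real"
  assumes g: "simple_graph n es"
  shows "(\<Sum>s<n. \<Sum>k\<in>{k. k < length es \<and> s \<in> es ! k}. f k) = 2 * (\<Sum>k<length es. f k)"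
proof -
  have "(\<Sum>s<n. \<Sum>k\<in>{k. k < length es \<and> s \<in> es ! k}. f k)
      = (\<Sum>s<n. \<Sum>k<length es. if s \<in> es ! k then f k else 0)"
  proof (rule sum.cong[OF refl])
    fix s
    have "{k. k < length es \<and> s \<in> es ! k} = {..<length es} \<inter> {k. s \<in> es ! k}" by auto
    thus "(\<Sum>k\<in>{k. k < length es \<and> s \<in> es ! k}. f k) = (\<Sum>k<length es. if s \<in> es ! k then f k else 0)"
      by (simp add: sum.inter_restrict)
  qed
  also have "\<dots> = (\<Sum>k<length es. \<Sum>s<n. if s \<in> es ! k then f k else 0)" by (rule sum.swap)
  also have "\<dots> = (\<Sum>k<length es. 2 * f k)"
  proof (rule sum.cong[OF refl])
    fix k assume "k \<in> {..<length es}"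
    hence *: "card (es ! k) = 2" "es ! k \<subseteq> {..<n}" using g by (auto simp: simple_graph_def)
    hence "{..<n} \<inter> es ! k = es ! k" by auto
    thus "(\<Sum>s<n. if s \<in> es ! k then f k else 0) = 2 * f k"
      using * by (simp add: sum.inter_restrict[symmetric])
  qed
  finally show ?thesis by (simp add: sum_distrib_left)
qed

lemma card_incident_edges_le:
  assumes g: "simple_graph n es" and s: "s < n"
  shows "card {k. k < length es \<and> s \<in> es ! k} \<le> max_degree n es"
proof -
  have "bij_betw (\<lambda>k. es ! k) {k. k < length es \<and> s \<in> es ! k} {e \<in> set es. s \<in> e}"
    using g by (auto simp: bij_betw_def inj_on_def simple_graph_def nth_eq_iff_index_eq in_set_conv_nth)
  hence "card {k. k < length es \<and> s \<in> es ! k} = degree_of es s"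
    unfolding degree_of_def by (rule bij_betw_same_card)
  thus ?thesis using s by (simp add: max_degree_def)
qed

text \<open>The star at \<open>s\<close> is a tree on \<open>d + 1\<close> vertices, with largest Laplacian eigenvalue \<open>d + 1\<close>.\<close>

lemma star_sum_le:
  assumes g: "simple_graph n es" and s: "s < n"
  shows "(\<Sum>k\<in>{k. k < length es \<and> s \<in> es ! k}. (dot n (edge_vec (es ! k)) z)\<^sup>2)
    \<le> (real (max_degree n es) + 1) * dot n z z"
proof -
  define E where "E = {k. k < length es \<and> s \<in> es ! k}"
  define D where "D = real (card E)"
  \<comment> \<open>Here \<open>t\<close> is the other endpoint of the edge; squaring removes the
    orientation.\<close>
  have "\<exists>t. t < n \<and> t \<noteq> s \<and> es ! k = {s, t} \<and> (dot n (edge_vec (es ! k)) z)\<^sup>2 = (z s - z t)\<^sup>2" if "k \<in> E" for k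
  proof -
    have k: "k < length es" "s \<in> es ! k" using that by (auto simp: E_def)
    obtain a b where ab: "a < b" "b < n" "es ! k = {a, b}"
      "edge_vec (es ! k) = (\<lambda>s. of_bool (s = a) - of_bool (s = b))"
      using edge_cases[OF g k(1)] by blast
    have "dot n (edge_vec (es ! k)) z = z a - z b"
      using dot_pair_vec[of a n b z] ab unfolding ab(4) by (simp add: pair_vec_def[abs_def])
    moreover have "s = a \<or> s = b" using ab(3) k(2) by auto
    ultimately show ?thesis
    proof (elim disjE)
      assume "s = b"
      with \<open>dot n _ z = _\<close> ab(1,2,3) show ?thesis
        by (intro exI[of _ a]) (simp add: insert_commute power2_commute)
    qed (use ab(1,2,3) in \<open>intro exI[of _ b], simp\<close>)
  qed
  then obtain t where t: "\<And>k. k \<in> E \<Longrightarrow> t k < n \<and> t k \<noteq> s \<and> es ! k = {s, t k} \<and>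
      (dot n (edge_vec (es ! k)) z)\<^sup>2 = (z s - z (t k))\<^sup>2" by metis
  have fin: "finite E" by (simp add: E_def)
  have inj: "inj_on t E"
  proof (rule inj_onI)
    fix k l assume kl: "k \<in> E" "l \<in> E" "t k = t l"
    hence "es ! k = es ! l" using t by metis
    thus "k = l" using kl g by (auto simp: E_def simple_graph_def nth_eq_iff_index_eq)
  qed
  define S Q where "S = (\<Sum>k\<in>E. z (t k))" and "Q = (\<Sum>k\<in>E. (z (t k))\<^sup>2)"
  have SQ: "S\<^sup>2 \<le> D * Q"
    using Cauchy_Schwarz_ineq_sum[of "\<lambda>_. 1" "\<lambda>k. z (t k)" E] by (simp add: S_def Q_def D_def)
  \<comment> \<open>The neighbours \<open>t k\<close> are distinct and differ from \<open>s\<close>,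
    so these squares are part of |z|^2.\<close>
  have "(z s)\<^sup>2 + Q = (\<Sum>r\<in>insert s (t ` E). (z r)\<^sup>2)"
    using fin t by (subst sum.insert) (auto simp: Q_def sum.reindex[OF inj])
  also have "\<dots> \<le> (\<Sum>r<n. (z r)\<^sup>2)"
    by (rule sum_mono2) (use s t in auto)
  finally have le: "(z s)\<^sup>2 + Q \<le> dot n z z" by (simp add: dot_def power2_eq_square)
  have "(\<Sum>k\<in>E. (dot n (edge_vec (es ! k)) z)\<^sup>2) = (\<Sum>k\<in>E. (z s - z (t k))\<^sup>2)"
    using t by (intro sum.cong refl) metis
  also have "\<dots> = D * (z s)\<^sup>2 - 2 * z s * S + Q"
    by (simp add: power2_diff sum.distrib sum_subtractf S_def Q_def D_def sum_distrib_left)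
  \<comment> \<open>The right side minus the left side is (z s)^2 + 2 (z s) S + D Q, which is at
    least (z s + S)^2 by \<open>SQ\<close>.\<close>
  also have "\<dots> \<le> (D + 1) * ((z s)\<^sup>2 + Q)"
    using SQ zero_le_power2[of "z s + S"] by (simp add: power2_sum algebra_simps)
  also have "\<dots> \<le> (D + 1) * dot n z z"
    using le by (intro mult_left_mono) (auto simp: D_def)
  also have "\<dots> \<le> (real (max_degree n es) + 1) * dot n z z"
    using card_incident_edges_le[OF g s]
    by (intro mult_right_mono) (auto simp: D_def E_def dot_def intro!: sum_nonneg)
  finally show ?thesis by (simp add: E_def)
qed

lemma edge_vec_sum_restrict:
  "(\<Sum>k<length es. f k * edge_vec (es ! k) s) = (\<Sum>k\<in>{k. k < length es \<and> s \<in> es ! k}. f k * edge_vec (es ! k) s)"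
  by (rule sum.mono_neutral_right) (auto simp: edge_vec_def)

text \<open>At a vertex only its incident edges contribute. Cauchy-Schwarz separates the differences
  of z, bounded by \<open>star_sum_le\<close>, from the squares of v; summing over vertices counts
  each square of v twice.\<close>

lemma weighted_edge_sum_norm_le:
  assumes g: "simple_graph n es"
  shows "(\<Sum>s<n. (\<Sum>k<length es. v k * dot n (edge_vec (es ! k)) z * edge_vec (es ! k) s)\<^sup>2)
    \<le> 2 * (real (max_degree n es) + 1) * dot n z z * (\<Sum>k<length es. (v k)\<^sup>2)"
proof -
  define E where "E s = {k. k < length es \<and> s \<in> es ! k}" for s
  define C where "C = (real (max_degree n es) + 1) * dot n z z"
  have "(\<Sum>k<length es. v k * dot n (edge_vec (es ! k)) z * edge_vec (es ! k) s)\<^sup>2 \<le> C * (\<Sum>k\<in>E s. (v k)\<^sup>2)"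
    if s: "s < n" for s
  proof -
    have "(\<Sum>k<length es. v k * dot n (edge_vec (es ! k)) z * edge_vec (es ! k) s)
        = (\<Sum>k\<in>E s. (dot n (edge_vec (es ! k)) z) * (v k * edge_vec (es ! k) s))"
      unfolding edge_vec_sum_restrict E_def by (simp add: mult_ac)
    hence "(\<Sum>k<length es. v k * dot n (edge_vec (es ! k)) z * edge_vec (es ! k) s)\<^sup>2
        \<le> (\<Sum>k\<in>E s. (dot n (edge_vec (es ! k)) z)\<^sup>2) * (\<Sum>k\<in>E s. (v k * edge_vec (es ! k) s)\<^sup>2)"
      by (simp only: Cauchy_Schwarz_ineq_sum)
    also have "(\<Sum>k\<in>E s. (v k * edge_vec (es ! k) s)\<^sup>2) = (\<Sum>k\<in>E s. (v k)\<^sup>2)"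
      by (intro sum.cong) (auto simp: E_def edge_vec_def)
    also have "(\<Sum>k\<in>E s. (dot n (edge_vec (es ! k)) z)\<^sup>2) * (\<Sum>k\<in>E s. (v k)\<^sup>2) \<le> C * (\<Sum>k\<in>E s. (v k)\<^sup>2)"
      using star_sum_le[OF g s, of z] by (intro mult_right_mono sum_nonneg) (auto simp: C_def E_def)
    finally show ?thesis .
  qed
  hence "(\<Sum>s<n. (\<Sum>k<length es. v k * dot n (edge_vec (es ! k)) z * edge_vec (es ! k) s)\<^sup>2)
      \<le> (\<Sum>s<n. C * (\<Sum>k\<in>E s. (v k)\<^sup>2))"
    by (intro sum_mono) auto
  also have "\<dots> = C * (2 * (\<Sum>k<length es. (v k)\<^sup>2))"
    unfolding sum_distrib_left[symmetric] E_def sum_incident_edges[OF g] ..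
  finally show ?thesis unfolding C_def by (simp only: mult_ac)
qed

text \<open>The inner product of two edge vectors is 2 for equal edges, 1 or -1 for edges sharing
  one vertex, and 0 for disjoint ones. Its square is therefore the number of common vertices, plus 2
  when the edges coincide.\<close>

lemma dot_edge_vec_power2:
  assumes g: "simple_graph n es" and k: "k < length es" and l: "l < length es"
  shows "(dot n (edge_vec (es ! k)) (edge_vec (es ! l)))\<^sup>2
    = 2 * of_bool (k = l) + (\<Sum>s<n. of_bool (s \<in> es ! k) * of_bool (s \<in> es ! l))"
proof -
  obtain a b where ab: "a < b" "b < n" "es ! k = {a, b}"
    "edge_vec (es ! k) = (\<lambda>s. of_bool (s = a) - of_bool (s = b))"
    using edge_cases[OF g k] by blast
  obtain c d where cd: "c < d" "d < n" "es ! l = {c, d}"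
    "edge_vec (es ! l) = (\<lambda>s. of_bool (s = c) - of_bool (s = d))"
    using edge_cases[OF g l] by blast
  have dot: "dot n (edge_vec (es ! k)) (edge_vec (es ! l)) = edge_vec (es ! l) a - edge_vec (es ! l) b"
    using dot_pair_vec[of a n b "edge_vec (es ! l)"] ab unfolding ab(4) by (simp add: pair_vec_def[abs_def])
  have "k = l \<longleftrightarrow> es ! k = es ! l"
    using g k l by (auto simp: simple_graph_def nth_eq_iff_index_eq)
  hence kl: "k = l \<longleftrightarrow> a = c \<and> b = d"
    using ab cd by (auto simp: doubleton_eq_iff)
  have "(\<Sum>s<n. of_bool (s \<in> es ! k) * of_bool (s \<in> es ! l))
      = (\<Sum>s<n. (if s = a then of_bool (a = c \<or> a = d) else 0) + (if s = b then of_bool (b = c \<or> b = d) else 0) :: real)"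
    using ab cd by (intro sum.cong) auto
  also have "\<dots> = of_bool (a = c \<or> a = d) + of_bool (b = c \<or> b = d)"
    using ab by (simp add: sum.distrib)
  finally show ?thesis
    unfolding dot kl unfolding cd(4) using ab(1) cd(1) by auto
qed

text \<open>The matrix of squared inner products is 2 I + M^T M with M the unsigned vertex-edge
  incidence matrix.\<close>

lemma edge_gram_form:
  assumes g: "simple_graph n es"
  shows "(\<Sum>k<length es. \<Sum>l<length es. v k * v l * (dot n (edge_vec (es ! k)) (edge_vec (es ! l)))\<^sup>2)
    = 2 * (\<Sum>k<length es. (v k)\<^sup>2) + (\<Sum>s<n. (\<Sum>k\<in>{k. k < length es \<and> s \<in> es ! k}. v k)\<^sup>2)"
proof -
  let ?m = "length es"
  let ?i = "\<lambda>s k. of_bool (s \<in> es ! k) :: real"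
  have "(\<Sum>k<?m. \<Sum>l<?m. v k * v l * (dot n (edge_vec (es ! k)) (edge_vec (es ! l)))\<^sup>2)
      = (\<Sum>k<?m. \<Sum>l<?m. (if l = k then 2 * (v k * v l) else 0) + (\<Sum>s<n. (v k * ?i s k) * (v l * ?i s l)))"
  proof (intro sum.cong refl)
    fix k l assume "k \<in> {..<?m}" "l \<in> {..<?m}"
    hence kl: "k < ?m" "l < ?m" by auto
    show "v k * v l * (dot n (edge_vec (es ! k)) (edge_vec (es ! l)))\<^sup>2
      = (if l = k then 2 * (v k * v l) else 0) + (\<Sum>s<n. (v k * ?i s k) * (v l * ?i s l))"
      unfolding dot_edge_vec_power2[OF g kl] distrib_left sum_distrib_left
      by (intro arg_cong2[where f = "(+)"] sum.cong) auto
  qed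
  also have "\<dots> = 2 * (\<Sum>k<?m. (v k)\<^sup>2) + (\<Sum>k<?m. \<Sum>l<?m. \<Sum>s<n. (v k * ?i s k) * (v l * ?i s l))"
    by (simp add: sum.distrib sum_distrib_left power2_eq_square)
  also have "(\<Sum>k<?m. \<Sum>l<?m. \<Sum>s<n. (v k * ?i s k) * (v l * ?i s l))
      = (\<Sum>k<?m. \<Sum>s<n. \<Sum>l<?m. (v k * ?i s k) * (v l * ?i s l))"
    by (rule sum.cong[OF refl], rule sum.swap)
  also have "\<dots> = (\<Sum>s<n. \<Sum>k<?m. \<Sum>l<?m. (v k * ?i s k) * (v l * ?i s l))"
    by (rule sum.swap)
  also have "\<dots> = (\<Sum>s<n. (\<Sum>k<?m. v k * ?i s k)\<^sup>2)"
    by (simp only: power2_eq_square sum_product)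
  also have "\<dots> = (\<Sum>s<n. (\<Sum>k\<in>{k. k < ?m \<and> s \<in> es ! k}. v k)\<^sup>2)"
  proof (rule sum.cong[OF refl])
    fix s
    have "(\<Sum>k<?m. v k * ?i s k) = (\<Sum>k\<in>{k. k < ?m \<and> s \<in> es ! k}. v k * ?i s k)"
      by (rule sum.mono_neutral_right) auto
    thus "(\<Sum>k<?m. v k * ?i s k)\<^sup>2 = (\<Sum>k\<in>{k. k < ?m \<and> s \<in> es ! k}. v k)\<^sup>2" by simp
  qed
  finally show ?thesis .
qed

text \<open>The lower bound drops the vertex squares; the upper one uses Cauchy-Schwarz at each
  vertex, the maximum degree and the handshake argument.\<close>

lemma edge_gram_form_bounds:
  assumes g: "simple_graph n es"
  defines "N \<equiv> \<lambda>v. \<Sum>k<length es. (v k)\<^sup>2"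
    and "T \<equiv> \<lambda>v. \<Sum>k<length es. \<Sum>l<length es. v k * v l * (dot n (edge_vec (es ! k)) (edge_vec (es ! l)))\<^sup>2"
  shows "2 * N v \<le> T v" and "T v \<le> 2 * (real (max_degree n es) + 1) * N v"
proof -
  let ?E = "\<lambda>s. {k. k < length es \<and> s \<in> es ! k}"
  let ?R = "\<Sum>s<n. (\<Sum>k\<in>?E s. v k)\<^sup>2"
  have T: "T v = 2 * N v + ?R" unfolding T_def N_def by (rule edge_gram_form[OF g])
  have "?R \<ge> 0" by (intro sum_nonneg) auto
  thus "2 * N v \<le> T v" by (simp add: T)
  have "(\<Sum>k\<in>?E s. v k)\<^sup>2 \<le> real (max_degree n es) * (\<Sum>k\<in>?E s. (v k)\<^sup>2)" if s: "s < n" for s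
  proof -
    have "(\<Sum>k\<in>?E s. v k)\<^sup>2 \<le> real (card (?E s)) * (\<Sum>k\<in>?E s. (v k)\<^sup>2)"
      using Cauchy_Schwarz_ineq_sum[of "\<lambda>_. 1" v "?E s"] by simp
    also have "\<dots> \<le> real (max_degree n es) * (\<Sum>k\<in>?E s. (v k)\<^sup>2)"
      using card_incident_edges_le[OF g s] by (intro mult_right_mono sum_nonneg) auto
    finally show ?thesis .
  qed
  hence "?R \<le> (\<Sum>s<n. real (max_degree n es) * (\<Sum>k\<in>?E s. (v k)\<^sup>2))"
    by (intro sum_mono) auto
  also have "\<dots> = real (max_degree n es) * (2 * N v)"
    unfolding sum_distrib_left[symmetric] sum_incident_edges[OF g] N_def ..
  finally show "T v \<le> 2 * (real (max_degree n es) + 1) * N v"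
    by (simp add: T algebra_simps)
qed

text \<open>The computation behind the Schur product theorem: the form of an entrywise product of
  two weighted Gram matrices is a weighted sum of squares. Bounds on the weights
  \<open>h p * g q\<close> then bound the form.\<close>

lemma hadamard_gram_form:
  fixes v :: "nat \<Rightarrow> real"
  shows "(\<Sum>k<m. \<Sum>l<m. v k * v l * ((\<Sum>q<n. g q * \<beta> q k * \<beta> q l) * (\<Sum>p<n. h p * \<beta> p k * \<beta> p l)))
    = (\<Sum>p<n. \<Sum>q<n. h p * g q * (\<Sum>k<m. v k * \<beta> p k * \<beta> q k)\<^sup>2)"
proof -
  let ?F = "\<lambda>k l p q. h p * g q * ((v k * \<beta> p k * \<beta> q k) * (v l * \<beta> p l * \<beta> q l))"
  have "(\<Sum>k<m. \<Sum>l<m. v k * v l * ((\<Sum>q<n. g q * \<beta> q k * \<beta> q l) * (\<Sum>p<n. h p * \<beta> p k * \<beta> p l)))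
      = (\<Sum>k<m. \<Sum>l<m. \<Sum>q<n. \<Sum>p<n. ?F k l p q)"
    unfolding sum_product by (simp only: sum_distrib_left mult_ac)
  also have "\<dots> = (\<Sum>k<m. \<Sum>l<m. \<Sum>p<n. \<Sum>q<n. ?F k l p q)"
    by (rule sum.cong[OF refl], rule sum.cong[OF refl], rule sum.swap)
  also have "\<dots> = (\<Sum>k<m. \<Sum>p<n. \<Sum>l<m. \<Sum>q<n. ?F k l p q)"
    by (rule sum.cong[OF refl], rule sum.swap)
  also have "\<dots> = (\<Sum>p<n. \<Sum>k<m. \<Sum>l<m. \<Sum>q<n. ?F k l p q)"
    by (rule sum.swap)
  also have "\<dots> = (\<Sum>p<n. \<Sum>k<m. \<Sum>q<n. \<Sum>l<m. ?F k l p q)"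
    by (rule sum.cong[OF refl], rule sum.cong[OF refl], rule sum.swap)
  also have "\<dots> = (\<Sum>p<n. \<Sum>q<n. \<Sum>k<m. \<Sum>l<m. ?F k l p q)"
    by (rule sum.cong[OF refl], rule sum.swap)
  also have "\<dots> = (\<Sum>p<n. \<Sum>q<n. h p * g q * (\<Sum>k<m. v k * \<beta> p k * \<beta> q k)\<^sup>2)"
    unfolding power2_eq_square sum_product by (simp only: sum_distrib_left)
  finally show ?thesis .
qed

section \<open>The kernel of the Laplacian of a connected graph\<close>

lemma dot_edge_vec_const:
  assumes "simple_graph n es" "k < length es"
  shows "dot n (edge_vec (es ! k)) (\<lambda>_. c) = 0"
proof -
  obtain a b where ab: "a < b" "b < n" "es ! k = {a, b}"
    "edge_vec (es ! k) = (\<lambda>s. of_bool (s = a) - of_bool (s = b))"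
    using edge_cases[OF assms] by blast
  show ?thesis
    using dot_pair_vec[of a n b "\<lambda>_. c"] ab(1,2) unfolding ab(4) by (simp add: pair_vec_def[abs_def])
qed

text \<open>A vector orthogonal to an edge vector agrees at the two ends of the edge, and equality
  spreads along paths.\<close>

lemma constant_on_connected_graph:
  assumes g: "simple_graph n es" and conn: "connected_graph n es"
    and z: "\<And>k. k < length es \<Longrightarrow> dot n (edge_vec (es ! k)) z = 0"
    and st: "s < n" "t < n"
  shows "z s = z t"
proof -
  have step: "z u = z v" if uv: "{u, v} \<in> set es" for u v
  proof -
    obtain k where k: "k < length es" "es ! k = {u, v}" using uv by (auto simp: in_set_conv_nth)
    obtain a b where ab: "a < b" "b < n" "es ! k = {a, b}"
      "edge_vec (es ! k) = (\<lambda>s. of_bool (s = a) - of_bool (s = b))"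
      using edge_cases[OF g k(1)] by blast
    have "z a = z b"
      using z[OF k(1)] dot_pair_vec[of a n b z] ab unfolding ab(4) by (simp add: pair_vec_def[abs_def])
    thus ?thesis using k(2) ab(3) by (auto simp: doubleton_eq_iff)
  qed
  have "(s, t) \<in> {(u, v). {u, v} \<in> set es}\<^sup>*" using conn st by (simp add: connected_graph_def)
  thus ?thesis by (induction rule: rtrancl_induct) (auto dest: step)
qed

text \<open>Indices start at 0, so \<open>e (n - 2)\<close> is the second smallest eigenvalue. Were
  it 0, two orthogonal unit eigenvectors would both be constant, which is impossible.\<close>

lemma algebraic_connectivity_pos:
  fixes e :: "nat \<Rightarrow> real"
  assumes g: "simple_graph n es" and conn: "connected_graph n es" and n: "2 \<le> n"
    and u: "orthonormal_basis n u"
    and nonneg: "\<And>k. k < n \<Longrightarrow> 0 \<le> e k"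
    and mono: "\<And>i j. i \<le> j \<Longrightarrow> j < n \<Longrightarrow> e j \<le> e i"
    and ker: "\<And>j k. j < n \<Longrightarrow> e j = 0 \<Longrightarrow> k < length es \<Longrightarrow> dot n (u j) (edge_vec (es ! k)) = 0"
  shows "0 < e (n - 2)"
proof (rule ccontr)
  assume "\<not> 0 < e (n - 2)"
  moreover have "0 \<le> e (n - 2)" using n by (intro nonneg) simp
  ultimately have e2: "e (n - 2) = 0" by linarith
  have "0 \<le> e (n - 1)" using n by (intro nonneg) simp
  moreover have "e (n - 1) \<le> e (n - 2)" using n by (intro mono) simp_all
  ultimately have e1: "e (n - 1) = 0" using e2 by linarith
  define c d where "c = u (n - 1) 0" and "d = u (n - 2) 0"
  have const: "u j s = u j 0" if "j < n" "e j = 0" "s < n" for j s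
    using constant_on_connected_graph[OF g conn, of "u j" s 0] ker[OF that(1,2)] that(3) n
    by (simp add: dot_commute)
  have c: "u (n - 1) s = c" and d: "u (n - 2) s = d" if "s < n" for s
    using const[OF _ e1 that] const[OF _ e2 that] n by (simp_all add: c_def d_def)
  have "dot n (u (n - 1)) (u (n - 1)) = real n * (c * c)"
    using c by (simp add: dot_def)
  moreover have "dot n (u (n - 2)) (u (n - 2)) = real n * (d * d)"
    using d by (simp add: dot_def)
  moreover have "dot n (u (n - 1)) (u (n - 2)) = real n * (c * d)"
    using c d by (simp add: dot_def)
  moreover have "n - 1 \<noteq> n - 2" using n by simp
  ultimately have "real n * (c * c) = 1" "real n * (d * d) = 1" "real n * (c * d) = 0"
    using u n by (auto simp: orthonormal_basis_def split: if_splits)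
  thus False by auto
qed

text \<open>The constant vector has zero Dirichlet energy, and in the eigenbasis this energy is a
  sum of nonnegative terms.\<close>

lemma dot_eigenvector_const:
  assumes g: "simple_graph n es" and x: "laplacian n es x = spectral_mat n u e"
    and nonneg: "\<And>k. k < n \<Longrightarrow> 0 \<le> e k"
    and p: "p < n" "e p \<noteq> 0"
  shows "dot n (u p) (\<lambda>_. 1) = 0"
proof -
  have "(\<Sum>k<n. e k * dot n (u k) (\<lambda>_. 1) * dot n (u k) (\<lambda>_. 1)) = 0"
    using bform_laplacian[OF g, of x "\<lambda>_. 1"] by (simp add: x bform_spectral_mat dot_edge_vec_const[OF g])
  hence "e p * dot n (u p) (\<lambda>_. 1) * dot n (u p) (\<lambda>_. 1) = 0"
    using p nonneg by (subst (asm) sum_nonneg_eq_0_iff) (auto simp: mult.assoc)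
  thus ?thesis using p by simp
qed

text \<open>Otherwise the constant vector 1 would be orthogonal to the whole basis, contradicting
  Parseval.\<close>

lemma least_eigenvalue_zero:
  assumes g: "simple_graph n es" and x: "laplacian n es x = spectral_mat n u e" and n: "0 < n"
    and u: "orthonormal_basis n u"
    and nonneg: "\<And>k. k < n \<Longrightarrow> 0 \<le> e k"
    and mono: "\<And>i j. i \<le> j \<Longrightarrow> j < n \<Longrightarrow> e j \<le> e i"
  shows "e (n - 1) = 0"
proof (rule ccontr)
  assume "e (n - 1) \<noteq> 0"
  with nonneg[of "n - 1"] n have pos: "0 < e (n - 1)" by simp
  have "e k \<noteq> 0" if "k < n" for k
    using mono[of k "n - 1"] that pos by fastforce
  hence "dot n (u k) (\<lambda>_. 1) = 0" if "k < n" for k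
    using dot_eigenvector_const[OF g x nonneg] that by blast
  hence "dot n (\<lambda>_. 1) (\<lambda>_. 1) = 0"
    using parseval[OF u, of "\<lambda>_. 1" "\<lambda>_. 1"] by simp
  thus False using n by (simp add: dot_def)
qed

section \<open>Eigenvalue bounds\<close>

lemma green_quadratic_form:
  "(\<Sum>k\<in>K. \<Sum>l\<in>K. w k * w l * green n es (b k) (b l) x)
    = green n es (\<lambda>s. \<Sum>k\<in>K. w k * b k s) (\<lambda>s. \<Sum>k\<in>K. w k * b k s) x"
proof -
  have lin: "bform n M p (\<lambda>s. \<Sum>k\<in>K. w k * b k s) = (\<Sum>k\<in>K. w k * bform n M p (b k))" for M p
  proof -
    have "apply_mat n M (\<lambda>s. \<Sum>k\<in>K. w k * b k s) = (\<lambda>s. \<Sum>k\<in>K. w k * apply_mat n M (b k) s)"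
    proof
      fix s
      show "apply_mat n M (\<lambda>s. \<Sum>k\<in>K. w k * b k s) s = (\<Sum>k\<in>K. w k * apply_mat n M (b k) s)"
        using dot_sum_right[of n "\<lambda>t. M $$ (s, t)" w b K] by (simp add: apply_mat_def dot_def)
    qed
    thus ?thesis by (simp add: bform_apply_mat dot_sum_right)
  qed
  have lin': "bform n M (\<lambda>s. \<Sum>k\<in>K. w k * b k s) q = (\<Sum>k\<in>K. w k * bform n M (b k) q)" for M q
    using dot_sum_right[of n "apply_mat n M q" w b K] by (simp add: bform_apply_mat dot_commute)
  show ?thesis
    unfolding green_def by (subst lin') (simp add: lin sum_distrib_left mult_ac)
qed

text \<open>The case \<open>a = 0\<close> rests on \<open>inverse 0 = 0\<close> and lets kernel
  directions share the bound by the spectral gap.\<close>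

lemma inverse_le_inverse_or_zero:
  fixes a b :: real
  assumes "0 < b" "b \<le> a \<or> a = 0"
  shows "inverse a \<le> inverse b"
  using assms by (auto intro: le_imp_inverse_le)

text \<open>The pseudoinverse of L^2 is the square of L^+, so its quadratic form at d is |L^+
  d|^2.\<close>

lemma biharmonic_eq:
  assumes g: "simple_graph n es" and x: "positive_weights es x" and ij: "i < n" "j < n"
  defines "z \<equiv> apply_mat n (pinv (laplacian n es x)) (pair_vec i j)"
  shows "biharmonic n es i j x = dot n z z"
proof -
  obtain u e where ue: "orthonormal_basis n u" "laplacian n es x = spectral_mat n u e"
    "pinv (laplacian n es x) = spectral_mat n u (\<lambda>k. inverse (e k))"
    using laplacian_spectrum[OF g x] by metis
  have "laplacian n es x ^\<^sub>m 2 = laplacian n es x * laplacian n es x"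
    by (simp add: numeral_2_eq_2 left_mult_one_mat[OF laplacian_carrier]
        laplacian_carrier[THEN carrier_matD(1)])
  hence "pinv (laplacian n es x ^\<^sub>m 2) = spectral_mat n u (\<lambda>k. inverse (e k * e k))"
    by (simp add: ue(2) spectral_mat_mult[OF ue(1)] pinv_spectral_mat[OF ue(1)])
  hence "biharmonic n es i j x
      = (\<Sum>k<n. inverse (e k * e k) * dot n (u k) (pair_vec i j) * dot n (u k) (pair_vec i j))"
    by (simp add: biharmonic_def pair_entry_eq_bform[OF ij] bform_spectral_mat)
  also have "\<dots> = (\<Sum>k<n. dot n (u k) z * dot n (u k) z)"
    by (intro sum.cong refl) (simp add: z_def ue(3) dot_apply_spectral_mat[OF ue(1)])
  also have "\<dots> = dot n z z" by (rule parseval[OF ue(1)])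
  finally show ?thesis .
qed

lemma hessian_carrier: "hessian f x \<in> carrier_mat (dim_vec x) (dim_vec x)"
  by (simp add: hessian_def)

lemma edges_imp_two_vertices:
  assumes "simple_graph n es" "k < length es"
  shows "2 \<le> n"
  by (rule edge_cases[OF assms]) linarith

text \<open>The quadratic form at v is 2 y^T L^+ y with y the sum of the v_k c_k b_k. It is at most
  2 |y|^2 / \<open>\<rho>\<close>, and |y|^2 is bounded through z = L^+ d, whose squared norm is the
  biharmonic distance.\<close>

lemma resistance_hessian_eigenvalue_le:
  assumes g: "simple_graph n es" and conn: "connected_graph n es" and x: "positive_weights es x"
    and ij: "i < n" "j < n" and ev: "eigenvalue (hessian (resistance n es i j) x) \<mu>"
  shows "\<mu> \<le> 4 * (real (max_degree n es) + 1) / kth_eigenvalue (laplacian n es x) (n - 1)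
    * biharmonic n es i j x"
proof -
  let ?m = "length es"
  define b where "b k = edge_vec (es ! k)" for k
  define d where "d = pair_vec i j"
  define z where "z = apply_mat n (pinv (laplacian n es x)) d"
  obtain u e where ue: "orthonormal_basis n u" "laplacian n es x = spectral_mat n u e"
    "pinv (laplacian n es x) = spectral_mat n u (\<lambda>k. inverse (e k))"
    "\<And>i j. i \<le> j \<Longrightarrow> j < n \<Longrightarrow> e j \<le> e i"
    "\<And>k. k < n \<Longrightarrow> kth_eigenvalue (laplacian n es x) (Suc k) = e k"
    "\<And>k. k < n \<Longrightarrow> 0 \<le> e k"
    "\<And>j k. j < n \<Longrightarrow> e j = 0 \<Longrightarrow> k < length es \<Longrightarrow> dot n (u j) (edge_vec (es ! k)) = 0"
    by (rule laplacian_spectrum[OF g x], rule that) simp_all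
  have "dim_vec x = ?m" using x by (simp add: positive_weights_def)
  hence H: "hessian (resistance n es i j) x \<in> carrier_mat ?m ?m"
    using hessian_carrier by metis
  obtain v where v: "0 < (\<Sum>k<?m. (v k)\<^sup>2)"
    "(\<Sum>k<?m. \<Sum>l<?m. v k * hessian (resistance n es i j) x $$ (k, l) * v l) = \<mu> * (\<Sum>k<?m. (v k)\<^sup>2)"
    using quadratic_form_eigenvalue[OF H ev] by blast
  define N where "N = (\<Sum>k<?m. (v k)\<^sup>2)"
  \<comment> \<open>A Hessian with an eigenvalue is nonempty, so there is an edge and hence
    \<open>n - 2\<close> is a genuine index.\<close>
  have "?m \<noteq> 0" using v(1) by (metis lessThan_0 less_irrefl sum.empty)
  hence n: "2 \<le> n" using edges_imp_two_vertices[OF g, of 0] by simp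
  define \<rho> where "\<rho> = e (n - 2)"
  have \<rho>: "0 < \<rho>"
    unfolding \<rho>_def by (rule algebraic_connectivity_pos[where u = u, OF g conn n ue(1) ue(6) ue(4) ue(7)])
  have e_last: "e (n - 1) = 0"
    by (rule least_eigenvalue_zero[OF g ue(2) _ ue(1) ue(6) ue(4)]) (use n in auto)
  have inv: "inverse (e k) \<le> inverse \<rho>" if "k < n" for k
  proof (rule inverse_le_inverse_or_zero[OF \<rho>])
    show "\<rho> \<le> e k \<or> e k = 0"
      using ue(4)[of k "n - 2"] e_last that n by (cases "k = n - 1") (auto simp: \<rho>_def)
  qed
  have "Suc (n - 2) = n - 1" using n by simp
  hence kth: "kth_eigenvalue (laplacian n es x) (n - 1) = \<rho>"
    using ue(5)[of "n - 2"] n unfolding \<rho>_def by (metis diff_less less_le_trans pos2)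
  define c where "c k = green n es d (b k) x" for k
  define y where "y = (\<lambda>s. \<Sum>k<?m. (v k * c k) * b k s)"
  have c: "c k = dot n (b k) z" for k
    using green_commute[OF g x, of d "b k"] by (simp add: c_def z_def green_def bform_apply_mat)
  have hess: "hessian (resistance n es i j) x $$ (k, l) = 2 * (c k * c l) * green n es (b k) (b l) x"
    if "k < ?m" "l < ?m" for k l
    using hessian_green_sum[OF g x that, of "\<lambda>_. d" "{()}"]
    by (simp add: resistance_eq_green[OF ij, abs_def] c_def b_def d_def)
  have "\<mu> * N = (\<Sum>k<?m. \<Sum>l<?m. 2 * ((v k * c k) * (v l * c l) * green n es (b k) (b l) x))"
    unfolding N_def v(2)[symmetric] by (intro sum.cong refl) (simp add: hess mult_ac)
  also have "\<dots> = 2 * (\<Sum>k<?m. \<Sum>l<?m. (v k * c k) * (v l * c l) * green n es (b k) (b l) x)"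
    by (simp only: sum_distrib_left)
  also have "\<dots> = 2 * green n es y y x"
    unfolding y_def green_quadratic_form ..
  also have "green n es y y x = (\<Sum>p<n. inverse (e p) * (dot n (u p) y * dot n (u p) y))"
    by (simp add: green_def ue(3) bform_spectral_mat mult.assoc)
  also have "\<dots> \<le> (\<Sum>p<n. inverse \<rho> * (dot n (u p) y * dot n (u p) y))"
    by (intro sum_mono mult_right_mono inv) auto
  also have "\<dots> = inverse \<rho> * dot n y y"
    by (simp only: sum_distrib_left[symmetric] parseval[OF ue(1)])
  also have "dot n y y \<le> 2 * (real (max_degree n es) + 1) * dot n z z * N"
    using weighted_edge_sum_norm_le[OF g, of v z] unfolding dot_def[of n y y] unfolding power2_eq_square y_def c N_def b_def .
  finally have "\<mu> * N \<le> 2 * (inverse \<rho> * (2 * (real (max_degree n es) + 1) * dot n z z * N))"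
    using \<rho> by simp
  also have "\<dots> = (4 * (real (max_degree n es) + 1) / \<rho> * dot n z z) * N"
    by (simp add: field_simps)
  finally have "\<mu> \<le> 4 * (real (max_degree n es) + 1) / \<rho> * dot n z z"
    using v(1) unfolding N_def by (rule mult_right_le_imp_le)
  thus ?thesis
    by (simp only: kth biharmonic_eq[OF g x ij] z_def d_def)
qed

text \<open>With z_k = L^+ b_k, the sum over vertex pairs collapses to n times the inner product of
  z_k and z_l, which is b_k^T (L^+)^2 b_l.\<close>

lemma kirchhoff_hessian_entry:
  assumes g: "simple_graph n es" and x: "positive_weights es x"
    and u: "orthonormal_basis n u" and L: "laplacian n es x = spectral_mat n u e"
    and nonneg: "\<And>k. k < n \<Longrightarrow> 0 \<le> e k"
    and kl: "k < length es" "l < length es"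
  defines "\<beta> \<equiv> \<lambda>p k. dot n (u p) (edge_vec (es ! k))"
  shows "hessian (kirchhoff n es) x $$ (k, l) = 2 * real n *
    ((\<Sum>q<n. inverse (e q * e q) * \<beta> q k * \<beta> q l) * (\<Sum>p<n. inverse (e p) * \<beta> p k * \<beta> p l))"
proof -
  define b where "b k = edge_vec (es ! k)" for k
  define z where "z k = apply_mat n (pinv (laplacian n es x)) (b k)" for k
  have X: "pinv (laplacian n es x) = spectral_mat n u (\<lambda>k. inverse (e k))"
    unfolding L by (rule pinv_spectral_mat[OF u])
  have c: "green n es (pair_vec i j) (b k) x = z k i - z k j" if "i < n" "j < n" for i j k
    using that by (simp add: green_def bform_apply_mat z_def dot_pair_vec)
  have "(\<Sum>i<n. z k i) = bform n (pinv (laplacian n es x)) (\<lambda>_. 1) (b k)" for k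
    by (simp add: bform_apply_mat z_def dot_def)
  also have "\<dots> k = (\<Sum>p<n. inverse (e p) * dot n (u p) (\<lambda>_. 1) * dot n (u p) (b k))" for k
    by (simp add: X bform_spectral_mat)
  \<comment> \<open>Eigenvectors with nonzero eigenvalue are orthogonal to constants; the others
    have coefficient \<open>inverse 0 = 0\<close>.\<close>
  also have "\<dots> k = 0" for k
  proof (intro sum.neutral ballI)
    fix p assume "p \<in> {..<n}"
    thus "inverse (e p) * dot n (u p) (\<lambda>_. 1) * dot n (u p) (b k) = 0"
      using dot_eigenvector_const[OF g L nonneg, of p] by (cases "e p = 0") auto
  qed
  finally have z_sum: "(\<Sum>i<n. z k i) = 0" for k .
  let ?I = "Sigma {..<n} (\<lambda>j. {..<j})"
  have "hessian (kirchhoff n es) x $$ (k, l)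
      = (\<Sum>a\<in>?I. 2 * (green n es (pair_vec (snd a) (fst a)) (b k) x * green n es (pair_vec (snd a) (fst a)) (b l) x)
          * green n es (b k) (b l) x)"
    using hessian_green_sum[OF g x kl, of "\<lambda>a. pair_vec (snd a) (fst a)" ?I]
    by (simp add: kirchhoff_eq_green[abs_def] case_prod_unfold b_def)
  also have "\<dots> = (\<Sum>a\<in>?I. (z k (snd a) - z k (fst a)) * (z l (snd a) - z l (fst a))) * (2 * green n es (b k) (b l) x)"
    unfolding sum_distrib_right by (intro sum.cong refl) (auto simp: c)
  also have "(\<Sum>a\<in>?I. (z k (snd a) - z k (fst a)) * (z l (snd a) - z l (fst a)))
      = (\<Sum>j<n. \<Sum>i<j. (z k i - z k j) * (z l i - z l j))"
    by (simp add: sum.Sigma case_prod_unfold)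
  also have "\<dots> = real n * dot n (z k) (z l)"
    by (simp add: sum_pairwise_differences z_sum dot_def)
  also have "dot n (z k) (z l) = (\<Sum>q<n. dot n (u q) (z k) * dot n (u q) (z l))"
    by (rule parseval[OF u, symmetric])
  also have "\<dots> = (\<Sum>q<n. inverse (e q * e q) * \<beta> q k * \<beta> q l)"
    by (intro sum.cong refl) (simp add: z_def X dot_apply_spectral_mat[OF u] \<beta>_def b_def)
  also have "green n es (b k) (b l) x = (\<Sum>p<n. inverse (e p) * \<beta> p k * \<beta> p l)"
    by (simp add: green_def X bform_spectral_mat \<beta>_def b_def)
  finally show ?thesis by (simp add: mult_ac)
qed

text \<open>In the eigenbasis the form is 2 n times a sum of squares \<open>S p q\<close> with
  weights 1 / (e_p e_q^2), each between the inverse cubes of the extremal nonzero eigenvalues. The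
  unweighted sum \<open>T\<close> is the edge Gram form.\<close>

lemma kirchhoff_hessian_eigenvalue_bounds:
  assumes g: "simple_graph n es" and conn: "connected_graph n es" and x: "positive_weights es x"
    and ev: "eigenvalue (hessian (kirchhoff n es) x) \<mu>"
  shows "4 * real n / kth_eigenvalue (laplacian n es x) 1 ^ 3 \<le> \<mu>"
    and "\<mu> \<le> 4 * real n * (real (max_degree n es) + 1) / kth_eigenvalue (laplacian n es x) (n - 1) ^ 3"
proof -
  let ?m = "length es"
  obtain u e where ue: "orthonormal_basis n u" "laplacian n es x = spectral_mat n u e"
    "pinv (laplacian n es x) = spectral_mat n u (\<lambda>k. inverse (e k))"
    "\<And>i j. i \<le> j \<Longrightarrow> j < n \<Longrightarrow> e j \<le> e i"
    "\<And>k. k < n \<Longrightarrow> kth_eigenvalue (laplacian n es x) (Suc k) = e k"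
    "\<And>k. k < n \<Longrightarrow> 0 \<le> e k"
    "\<And>j k. j < n \<Longrightarrow> e j = 0 \<Longrightarrow> k < length es \<Longrightarrow> dot n (u j) (edge_vec (es ! k)) = 0"
    by (rule laplacian_spectrum[OF g x], rule that) simp_all
  define \<beta> where "\<beta> p k = dot n (u p) (edge_vec (es ! k))" for p k
  have "dim_vec x = ?m" using x by (simp add: positive_weights_def)
  hence H: "hessian (kirchhoff n es) x \<in> carrier_mat ?m ?m"
    using hessian_carrier by metis
  obtain v where v: "0 < (\<Sum>k<?m. (v k)\<^sup>2)"
    "(\<Sum>k<?m. \<Sum>l<?m. v k * hessian (kirchhoff n es) x $$ (k, l) * v l) = \<mu> * (\<Sum>k<?m. (v k)\<^sup>2)"
    using quadratic_form_eigenvalue[OF H ev] by blast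
  define N where "N = (\<Sum>k<?m. (v k)\<^sup>2)"
  have N: "0 < N" using v(1) by (simp add: N_def)
  have "?m \<noteq> 0" using v(1) by (metis lessThan_0 less_irrefl sum.empty)
  hence n: "2 \<le> n" using edges_imp_two_vertices[OF g, of 0] by simp
  define \<rho> where "\<rho> = e (n - 2)"
  define \<Lambda> where "\<Lambda> = e 0"
  have \<rho>: "0 < \<rho>"
    unfolding \<rho>_def by (rule algebraic_connectivity_pos[where u = u, OF g conn n ue(1) ue(6) ue(4) ue(7)])
  have e_last: "e (n - 1) = 0"
    by (rule least_eigenvalue_zero[OF g ue(2) _ ue(1) ue(6) ue(4)]) (use n in auto)
  have e_range: "\<rho> \<le> e k \<and> e k \<le> \<Lambda>" if "k < n" "e k \<noteq> 0" for k
    using ue(4)[of k "n - 2"] ue(4)[of 0 k] e_last that n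
    by (cases "k = n - 1") (auto simp: \<rho>_def \<Lambda>_def)
  have \<Lambda>: "0 < \<Lambda>" using ue(4)[of 0 "n - 2"] n \<rho> by (simp add: \<rho>_def \<Lambda>_def)
  define S where "S p q = (\<Sum>k<?m. v k * \<beta> p k * \<beta> q k)\<^sup>2" for p q
  define T where "T = (\<Sum>p<n. \<Sum>q<n. S p q)"
  have S0: "S p q = 0" if "p < n" "q < n" "e p = 0 \<or> e q = 0" for p q
    using that ue(7) by (auto simp: S_def \<beta>_def)
  \<comment> \<open>The Schur product computation read backwards with all weights 1; Parseval then
    turns both factors into inner products of edge vectors.\<close>
  have "T = (\<Sum>k<?m. \<Sum>l<?m. v k * v l * ((\<Sum>q<n. 1 * \<beta> q k * \<beta> q l) * (\<Sum>p<n. 1 * \<beta> p k * \<beta> p l)))"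
    unfolding hadamard_gram_form by (simp add: T_def S_def)
  also have "\<dots> = (\<Sum>k<?m. \<Sum>l<?m. v k * v l * (dot n (edge_vec (es ! k)) (edge_vec (es ! l)))\<^sup>2)"
    by (simp add: \<beta>_def parseval[OF ue(1)] power2_eq_square)
  finally have T: "2 * N \<le> T" "T \<le> 2 * (real (max_degree n es) + 1) * N"
    using edge_gram_form_bounds[OF g, of v] by (simp_all add: N_def)
  have "\<mu> * N = (\<Sum>k<?m. \<Sum>l<?m. 2 * real n * (v k * v l *
      ((\<Sum>q<n. inverse (e q * e q) * \<beta> q k * \<beta> q l) * (\<Sum>p<n. inverse (e p) * \<beta> p k * \<beta> p l))))"
    unfolding N_def v(2)[symmetric] \<beta>_def
    by (intro sum.cong refl) (simp add: kirchhoff_hessian_entry[OF g x ue(1,2,6)])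
  also have "\<dots> = 2 * real n * (\<Sum>p<n. \<Sum>q<n. inverse (e p) * inverse (e q * e q) * S p q)"
    unfolding sum_distrib_left[symmetric] hadamard_gram_form S_def ..
  finally have \<mu>: "\<mu> * N = 2 * real n * (\<Sum>p<n. \<Sum>q<n. inverse (e p) * inverse (e q * e q) * S p q)" .
  \<comment> \<open>If an eigenvalue is 0 the weight is 0 as well, and the lower bound survives only
    because \<open>S p q\<close> vanishes there.\<close>
  have bounds: "inverse (\<Lambda> ^ 3) * S p q \<le> inverse (e p) * inverse (e q * e q) * S p q \<and>
      inverse (e p) * inverse (e q * e q) * S p q \<le> inverse (\<rho> ^ 3) * S p q"
    if pq: "p < n" "q < n" for p q
  proof (cases "e p = 0 \<or> e q = 0")
    case True
    thus ?thesis using S0[OF pq] by simp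
  next
    case False
    hence ep: "\<rho> \<le> e p" "e p \<le> \<Lambda>" and eq: "\<rho> \<le> e q" "e q \<le> \<Lambda>" using e_range pq by auto
    have "\<rho> * (\<rho> * \<rho>) \<le> e p * (e q * e q)" "e p * (e q * e q) \<le> \<Lambda> * (\<Lambda> * \<Lambda>)"
      using ep eq \<rho> by (intro mult_mono; simp)+
    moreover have "0 < \<rho> * (\<rho> * \<rho>)" "0 < e p * (e q * e q)" using \<rho> ep eq by simp_all
    ultimately have "inverse (\<Lambda> * (\<Lambda> * \<Lambda>)) \<le> inverse (e p * (e q * e q))"
      "inverse (e p * (e q * e q)) \<le> inverse (\<rho> * (\<rho> * \<rho>))"
      by (simp_all only: le_imp_inverse_le)
    hence "inverse (\<Lambda> ^ 3) \<le> inverse (e p) * inverse (e q * e q)"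
      "inverse (e p) * inverse (e q * e q) \<le> inverse (\<rho> ^ 3)"
      by (simp_all add: power3_eq_cube mult.assoc)
    moreover have "0 \<le> S p q" by (simp add: S_def)
    ultimately show ?thesis by (intro conjI mult_right_mono)
  qed
  have "inverse (\<Lambda> ^ 3) * T \<le> (\<Sum>p<n. \<Sum>q<n. inverse (e p) * inverse (e q * e q) * S p q)"
    unfolding T_def sum_distrib_left using bounds by (intro sum_mono) auto
  hence "2 * real n * (inverse (\<Lambda> ^ 3) * T) \<le> \<mu> * N"
    unfolding \<mu> by (intro mult_left_mono) auto
  moreover have "2 * real n * (inverse (\<Lambda> ^ 3) * (2 * N)) \<le> 2 * real n * (inverse (\<Lambda> ^ 3) * T)"
    using T(1) \<Lambda> by (intro mult_left_mono) auto
  ultimately have "4 * real n / \<Lambda> ^ 3 * N \<le> \<mu> * N" by (simp add: divide_inverse mult_ac)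
  hence "4 * real n / \<Lambda> ^ 3 \<le> \<mu>" using N by (rule mult_right_le_imp_le)
  thus "4 * real n / kth_eigenvalue (laplacian n es x) 1 ^ 3 \<le> \<mu>"
    using ue(5)[of 0] n by (simp add: \<Lambda>_def)
  have "(\<Sum>p<n. \<Sum>q<n. inverse (e p) * inverse (e q * e q) * S p q) \<le> inverse (\<rho> ^ 3) * T"
    unfolding T_def sum_distrib_left using bounds by (intro sum_mono) auto
  hence "\<mu> * N \<le> 2 * real n * (inverse (\<rho> ^ 3) * T)"
    unfolding \<mu> by (intro mult_left_mono) auto
  also have "\<dots> \<le> 2 * real n * (inverse (\<rho> ^ 3) * (2 * (real (max_degree n es) + 1) * N))"
    using T(2) \<rho> by (intro mult_left_mono) auto
  also have "\<dots> = 4 * real n * (real (max_degree n es) + 1) / \<rho> ^ 3 * N"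
    by (simp add: field_simps)
  finally have "\<mu> \<le> 4 * real n * (real (max_degree n es) + 1) / \<rho> ^ 3"
    using N by (rule mult_right_le_imp_le)
  moreover have "Suc (n - 2) = n - 1" using n by simp
  hence "kth_eigenvalue (laplacian n es x) (n - 1) = \<rho>"
    using ue(5)[of "n - 2"] n unfolding \<rho>_def by (metis diff_less less_le_trans pos2)
  ultimately show "\<mu> \<le> 4 * real n * (real (max_degree n es) + 1) / kth_eigenvalue (laplacian n es x) (n - 1) ^ 3"
    by simp
qed

theorem theorem3p4:
  fixes n m :: nat and es :: "nat set list" and x :: "real vec"
  assumes "simple_graph n es" and "connected_graph n es" and "length es = m"
    and "x \<in> carrier_vec m" and "\<forall>k<m. x $ k > 0"
  shows "(\<forall>i<n. \<forall>j<n. \<forall>\<mu>. eigenvalue (hessian (resistance n es i j) x) \<mu> \<longrightarrow>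
            \<mu> \<le> 4 * (real (max_degree n es) + 1) / kth_eigenvalue (laplacian n es x) (n - 1)
                  * biharmonic n es i j x) \<and>
         (\<forall>\<mu>. eigenvalue (hessian (kirchhoff n es) x) \<mu> \<longrightarrow>
            4 * real n / kth_eigenvalue (laplacian n es x) 1 ^ 3 \<le> \<mu> \<and>
            \<mu> \<le> 4 * real n * (real (max_degree n es) + 1)
                  / kth_eigenvalue (laplacian n es x) (n - 1) ^ 3)"
proof -
  have "positive_weights es x" using assms by (simp add: positive_weights_def)
  thus ?thesis
    using resistance_hessian_eigenvalue_le kirchhoff_hessian_eigenvalue_bounds assms(1,2) by blast
qed

end
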